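(* Let $\sigma(y)=\begin{pmatrix}1&0\\0&1\\2y_2&-2y_1\end{pmatrix}$ and $b(y)=-(k_1y_1,k_2y_2,k_3y_3)$ for $y=(y_1,y_2,y_3)\in\mathbb R^3$, with $k_1>4$, $k_2>4$, $k_3>0$. Let $F:\mathbb R^3\to\mathbb R$ be Lipschitz continuous with Lipschitz constant $L$, and suppose $|F(y)|\le C_F(|y|+1)$ for all $y\in\mathbb R^3$. For $\delta>0$ let $u_\delta$ be the unique continuous viscosity solution of $$\delta u_\delta-\mathrm{tr}(\sigma(y)\sigma^T(y)D^2u_\delta)-b(y)\cdot Du_\delta=F(y)\quad\text{in }\mathbb R^3$$ satisfying $|u_\delta(y)|\le C(|y|+\tfrac1\delta)$ for all $y\in\mathbb R^3$, where $C$ is a constant. Then for every concave increasing function $\psi\in C^2(\mathbb R)$, independent of $\delta$, with $\psi(0)=0$ and $\psi'>\max\{\frac{L}{k_1-4},\frac{L}{k_2-4},\frac{L}{k_3}\}$, there holds $$|u_\delta(y')-u_\delta(y)|\le\psi(|y'-y|)\qquad\forall y,y'\in\mathbb R^3.$$ In particular, with $l:=\min\{k_1-4,k_2-4,k_3\}$, for every $\overline L>L/l$, $$|u_\delta(y')-u_\delta(y)|\le\overline L\,|y'-y|\qquad\forall y,y'\in\mathbb R^3,\ \forall\delta>0.$$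
   Context: Solutions are understood in the viscosity sense. Existence and uniqueness of $u_\delta$ in the class of functions with the stated growth is known. *)

theory Defs
  imports "HOL-Analysis.Analysis"
begin

section \<open>Functions of class C^2\<close>

definition C2_real :: "(real \<Rightarrow> real) \<Rightarrow> bool" where
  "C2_real \<psi> \<longleftrightarrow>
     (\<forall>s. \<psi> differentiable at s) \<and>
     (\<forall>s. deriv \<psi> differentiable at s) \<and>
     continuous_on UNIV (deriv (deriv \<psi>))"

text \<open>\<open>C2_on_Rn \<phi> D\<phi> D2\<phi>\<close>: the function \<open>\<phi>\<close> is of class C^2 on the whole space, with gradient
  \<open>D\<phi>\<close> and Hessian matrix \<open>D2\<phi>\<close>, the latter being the Jacobian of the gradient.\<close>

definition C2_on_Rn ::
    "(real^'n \<Rightarrow> real) \<Rightarrow> (real^'n \<Rightarrow> real^'n) \<Rightarrow> (real^'n \<Rightarrow> real^'n^'n) \<Rightarrow> bool" where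
  "C2_on_Rn \<phi> D\<phi> D2\<phi> \<longleftrightarrow>
     (\<forall>x. GDERIV \<phi> x :> D\<phi> x) \<and>
     (\<forall>x. (D\<phi> has_derivative (\<lambda>h. D2\<phi> x *v h)) (at x)) \<and>
     continuous_on UNIV D2\<phi>"

section \<open>Viscosity solutions\<close>

text \<open>An equation \<open>G(x, u, Du, D\<^sup>2u) = 0\<close> is given by its left-hand side
  \<open>G x r p X\<close>. The sign convention is that of equations for which \<open>G\<close> is nonincreasing in \<open>X\<close>
  (as in \<open>-tr(A X)\<close> with \<open>A \<ge> 0\<close>): a subsolution satisfies \<open>G \<le> 0\<close> where \<open>u - \<phi>\<close> has a local
  maximum. Only continuous functions are considered, hence no semicontinuous envelopes.\<close>

definition viscosity_subsolution ::
    "(real^'n \<Rightarrow> real \<Rightarrow> real^'n \<Rightarrow> real^'n^'n \<Rightarrow> real) \<Rightarrow> (real^'n \<Rightarrow> real) \<Rightarrow> bool" where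
  "viscosity_subsolution G u \<longleftrightarrow>
     (\<forall>\<phi> D\<phi> D2\<phi> x. C2_on_Rn \<phi> D\<phi> D2\<phi> \<longrightarrow>
        (\<forall>\<^sub>F z in nhds x. u z - \<phi> z \<le> u x - \<phi> x) \<longrightarrow>
        G x (u x) (D\<phi> x) (D2\<phi> x) \<le> 0)"

definition viscosity_supersolution ::
    "(real^'n \<Rightarrow> real \<Rightarrow> real^'n \<Rightarrow> real^'n^'n \<Rightarrow> real) \<Rightarrow> (real^'n \<Rightarrow> real) \<Rightarrow> bool" where
  "viscosity_supersolution G u \<longleftrightarrow>
     (\<forall>\<phi> D\<phi> D2\<phi> x. C2_on_Rn \<phi> D\<phi> D2\<phi> \<longrightarrow>
        (\<forall>\<^sub>F z in nhds x. u z - \<phi> z \<ge> u x - \<phi> x) \<longrightarrow>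
        G x (u x) (D\<phi> x) (D2\<phi> x) \<ge> 0)"

definition continuous_viscosity_solution ::
    "(real^'n \<Rightarrow> real \<Rightarrow> real^'n \<Rightarrow> real^'n^'n \<Rightarrow> real) \<Rightarrow> (real^'n \<Rightarrow> real) \<Rightarrow> bool" where
  "continuous_viscosity_solution G u \<longleftrightarrow>
     continuous_on UNIV u \<and> viscosity_subsolution G u \<and> viscosity_supersolution G u"

section \<open>The Ornstein--Uhlenbeck equation on the Heisenberg group\<close>

definition sigma :: "real^3 \<Rightarrow> real^2^3" where
  "sigma y = vector [vector [1, 0],
                     vector [0, 1],
                     vector [2 * y$2, - 2 * y$1]]"

definition drift :: "real \<Rightarrow> real \<Rightarrow> real \<Rightarrow> real^3 \<Rightarrow> real^3" where
  "drift k1 k2 k3 y = - vector [k1 * y$1, k2 * y$2, k3 * y$3]"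

definition OU_equation ::
    "real \<Rightarrow> real \<Rightarrow> real \<Rightarrow> (real^3 \<Rightarrow> real) \<Rightarrow> real \<Rightarrow>
     real^3 \<Rightarrow> real \<Rightarrow> real^3 \<Rightarrow> real^3^3 \<Rightarrow> real" where
  "OU_equation k1 k2 k3 F \<delta> y r p X =
     \<delta> * r - trace (sigma y ** transpose (sigma y) ** X) - drift k1 k2 k3 y \<bullet> p - F y"

text \<open>Solutions in the growth class in which the equation is uniquely solvable; the constant \<open>C\<close> may
  be any real number.\<close>

definition is_u_delta ::
    "real \<Rightarrow> real \<Rightarrow> real \<Rightarrow> (real^3 \<Rightarrow> real) \<Rightarrow> real \<Rightarrow> (real^3 \<Rightarrow> real) \<Rightarrow> bool" where
  "is_u_delta k1 k2 k3 F \<delta> u \<longleftrightarrow>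
     continuous_viscosity_solution (OU_equation k1 k2 k3 F \<delta>) u \<and>
     (\<exists>C. \<forall>y. \<bar>u y\<bar> \<le> C * (norm y + 1 / \<delta>))"

end

theory Submission
  imports Defs
begin

text \<open>
  Let \<open>l = min (k1 - 4) (k2 - 4) k3\<close>. Since \<open>\<psi>' > L / l\<close> everywhere and \<open>\<psi> 0 = 0\<close>, the mean value theorem
  gives \<open>\<psi> s \<ge> (L / l) * s\<close> for \<open>s \<ge> 0\<close>. Both claims therefore follow from one fact: \<open>u\<^sub>\<delta>\<close> is
  Lipschitz with constant \<open>L / l\<close>.

  Probabilistically the reason is a synchronous coupling. The equation belongs to the diffusion
  \<open>dX = b(X) dt + sqrt 2 \<sigma>(X) dW\<close>, and \<open>u\<^sub>\<delta>(x)\<close> is the integral over time of \<open>exp (- \<delta> t) * E F(X\<^sub>t)\<close>, with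
  \<open>X\<close> started at \<open>x\<close>. If two copies are driven by the same noise, their difference \<open>z\<close> solves a linear
  equation with \<open>d/dt E |z|\<^sup>2 = - 2 E ((k1 - 4) z\<^sub>1\<^sup>2 + (k2 - 4) z\<^sub>2\<^sup>2 + k3 z\<^sub>3\<^sup>2) \<le> - 2 l E |z|\<^sup>2\<close>, the number \<open>4\<close>
  coming from the noise \<open>2 sqrt 2 (z\<^sub>2 dW\<^sub>1 - z\<^sub>1 dW\<^sub>2)\<close> of the third component. Thus trajectories approach
  each other at rate \<open>l\<close>.

  The proof below uses a discrete version of this coupling and no stochastic calculus. A time step
  of length \<open>h\<close> moves \<open>x\<close> at random, by an affine map, either along the drift or along one of the two
  columns of \<open>\<sigma>\<close>; \<open>transition\<close> is the averaging operator of that step, and the functions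
  \<open>v\<^sub>0 = 0\<close>, \<open>v\<^sub>n\<^sub>+\<^sub>1 = (h F + transition v\<^sub>n) / (1 + \<delta> h)\<close> are the discounted sums of \<open>F\<close> along
  \<open>n\<close> steps. Because the steps are affine, the \<open>v\<^sub>n\<close> are as smooth as \<open>F\<close>, and every increment or Taylor remainder
  of \<open>v\<^sub>n\<close> is an average of those of \<open>F\<close>, evaluated at displacements that evolve by the linear
  parts of the steps (\<open>iteration_bound\<close>). Three functions of the displacement that decrease in mean
  then give: the Lipschitz constant \<open>L / l\<close> (\<open>iterate_lipschitz\<close>, with the norm), and first and second
  order Taylor bounds independent of \<open>h\<close> and \<open>n\<close> (\<open>iterate_first_order\<close>, \<open>iterate_second_order\<close>, with
  the squared norm and a fourth-order form). By the Taylor bounds, \<open>v\<^sub>n\<close> solves the equation up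
  to an arbitrarily small error on any given ball (\<open>approximate_solution\<close>).

  Such a smooth \<open>v\<^sub>n\<close> can be compared with the viscosity solution directly: \<open>v\<^sub>n\<close> plus a small multiple of
  \<open>4 / \<delta> + |x|\<^sup>2\<close> is an admissible test function
  (\<open>subsolution_le_approximate_supersolution\<close>). As only one of the two functions compared is
  nonsmooth, no doubling of variables is needed. The function \<open>F\<close>, which is merely Lipschitz, is first
  replaced by a smooth average of its translates, with the same Lipschitz constant
  (\<open>lipschitz_mollification\<close>).
\<close>

section \<open>Functions of class C^2\<close>

lemma inner_transpose:
  fixes M :: "real^'n^'n"
  shows "x \<bullet> (transpose M *v y) = (M *v x) \<bullet> y"
  by (metis dot_lmul_matrix vector_transpose_matrix transpose_transpose)

lemma quadratic_form_congruence:
  fixes M A :: "real^'n^'n"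
  shows "x \<bullet> ((transpose M ** A ** M) *v x) = (M *v x) \<bullet> (A *v (M *v x))"
  by (simp add: matrix_vector_mul_assoc[symmetric] inner_commute[of x] dot_lmul_matrix)
    (simp add: inner_commute)

lemma continuous_on_matrix_mult_left:
  fixes M :: "real^'n^'n" and H :: "real^'n \<Rightarrow> real^'n^'n"
  assumes "continuous_on UNIV H"
  shows "continuous_on UNIV (\<lambda>x. M ** H x)"
proof -
  have "bounded_linear (\<lambda>A::real^'n^'n. M ** A)"
    by (simp add: linear_conv_bounded_linear[symmetric] linear_iff
        matrix_matrix_mult_def vec_eq_iff sum_distrib_left algebra_simps sum.distrib)
  then show ?thesis
    using assms bounded_linear.continuous_on by blast
qed

lemma continuous_on_matrix_mult_right:
  fixes M :: "real^'n^'n" and H :: "real^'n \<Rightarrow> real^'n^'n"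
  assumes "continuous_on UNIV H"
  shows "continuous_on UNIV (\<lambda>x. H x ** M)"
proof -
  have "bounded_linear (\<lambda>A::real^'n^'n. A ** M)"
    by (simp add: linear_conv_bounded_linear[symmetric] linear_iff
        matrix_matrix_mult_def vec_eq_iff sum_distrib_left algebra_simps sum.distrib)
  then show ?thesis
    using assms bounded_linear.continuous_on by blast
qed

lemma mult_scaleR_matrix: "(*v) (c *\<^sub>R A) = (\<lambda>h. c *\<^sub>R (A *v h))"
  for A :: "real^'n^'n"
  by (simp add: fun_eq_iff scaleR_matrix_vector_assoc)

lemma mult_add_matrix: "(*v) (A + B) = (\<lambda>h. A *v h + B *v h)"
  for A :: "real^'n^'n"
  by (simp add: fun_eq_iff matrix_vector_mult_add_rdistrib)

lemma C2_on_Rn_affine: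
  fixes M :: "real^'n^'n" and c :: "real^'n"
  assumes "C2_on_Rn f D H"
  shows "C2_on_Rn (\<lambda>x. f (M *v x + c)) (\<lambda>x. transpose M *v D (M *v x + c))
           (\<lambda>x. transpose M ** H (M *v x + c) ** M)"
proof -
  let ?T = "\<lambda>x. M *v x + c"
  have T: "(?T has_derivative (\<lambda>h. M *v h)) (at x)" for x
    using has_derivative_add_const[OF bounded_linear_imp_has_derivative[OF matrix_vector_mul_bounded_linear]] .
  have f: "(f has_derivative (\<lambda>h. h \<bullet> D y)) (at y)" and D: "(D has_derivative (\<lambda>h. H y *v h)) (at y)" for y
    using assms by (auto simp: C2_on_Rn_def gderiv_def)
  have "((\<lambda>x. f (?T x)) has_derivative (\<lambda>h. (M *v h) \<bullet> D (?T x))) (at x)" for x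
    using has_derivative_compose[OF T f] .
  then have "GDERIV (\<lambda>x. f (?T x)) x :> transpose M *v D (?T x)" for x
    unfolding gderiv_def inner_transpose .
  moreover have "((\<lambda>x. transpose M *v D (?T x)) has_derivative
      (\<lambda>h. (transpose M ** H (?T x) ** M) *v h)) (at x)" for x
    using bounded_linear.has_derivative[OF matrix_vector_mul_bounded_linear
        has_derivative_compose[OF T D], of "transpose M" x]
    unfolding matrix_vector_mul_assoc matrix_mul_assoc .
  moreover have "continuous_on UNIV (\<lambda>x. transpose M ** H (?T x) ** M)"
  proof (intro continuous_on_matrix_mult_left continuous_on_matrix_mult_right)
    have cT: "continuous_on UNIV ?T"
      by (rule has_derivative_continuous_on[OF has_derivative_at_withinI[OF T]])
    have cH: "continuous_on UNIV H"
      using assms unfolding C2_on_Rn_def by blast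
    show "continuous_on UNIV (\<lambda>x. H (?T x))"
      by (rule continuous_on_compose2[OF cH cT]) simp
  qed
  ultimately show ?thesis
    unfolding C2_on_Rn_def by blast
qed

lemma C2_on_Rn_add:
  assumes "C2_on_Rn f D H" "C2_on_Rn g D' H'"
  shows "C2_on_Rn (\<lambda>x. f x + g x) (\<lambda>x. D x + D' x) (\<lambda>x. H x + H' x)"
  using assms has_derivative_add[of D _ _ D'] GDERIV_add[of f _ _ g] continuous_on_add[of UNIV H H']
  unfolding C2_on_Rn_def mult_add_matrix by blast

lemma C2_on_Rn_scaleR:
  fixes f :: "real^'n \<Rightarrow> real"
  assumes "C2_on_Rn f D H"
  shows "C2_on_Rn (\<lambda>x. c * f x) (\<lambda>x. c *\<^sub>R D x) (\<lambda>x. c *\<^sub>R H x)"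
proof -
  have f: "(f has_derivative (\<lambda>h. h \<bullet> D y)) (at y)"
    and D: "(D has_derivative (\<lambda>h. H y *v h)) (at y)"
    and H: "continuous_on UNIV H" for y
    using assms by (auto simp: C2_on_Rn_def gderiv_def)
  show ?thesis
    unfolding C2_on_Rn_def gderiv_def
    using has_derivative_mult_right[OF f, of c] has_derivative_scaleR_right[OF D, of c]
      continuous_on_scaleR[OF continuous_on_const H, of c]
    by (simp add: mult_scaleR_matrix)
qed

lemma C2_on_Rn_const: "C2_on_Rn (\<lambda>x::real^'n. c) (\<lambda>x. 0) (\<lambda>x. 0)"
  by (auto simp: C2_on_Rn_def gderiv_def)

lemma C2_on_Rn_norm_square: "C2_on_Rn (\<lambda>x::real^'n. x \<bullet> x) (\<lambda>x. 2 *\<^sub>R x) (\<lambda>x. 2 *\<^sub>R mat 1)"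
proof -
  have "((\<lambda>x::real^'n. x \<bullet> x) has_derivative (\<lambda>h. x \<bullet> h + h \<bullet> x)) (at x)" for x
    by (intro has_derivative_inner has_derivative_ident)
  moreover have "((\<lambda>x::real^'n. 2 *\<^sub>R x) has_derivative (\<lambda>h. 2 *\<^sub>R h)) (at x)" for x
    by (intro has_derivative_scaleR_right has_derivative_ident)
  ultimately show ?thesis
    by (simp add: C2_on_Rn_def gderiv_def mult_scaleR_matrix inner_commute)
qed

lemma C2_on_Rn_continuous_on:
  assumes "C2_on_Rn f D H"
  shows "continuous_on UNIV f"
proof -
  have "(f has_derivative (\<lambda>h. h \<bullet> D y)) (at y)" for y
    using assms by (auto simp: C2_on_Rn_def gderiv_def)
  from has_derivative_continuous_on[OF has_derivative_at_withinI[OF this]]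
  show ?thesis .
qed

lemma C2_on_Rn_line_derivatives:
  fixes f :: "real^'n \<Rightarrow> real"
  assumes "C2_on_Rn f D H"
  shows "((\<lambda>s. f (x + s *\<^sub>R z)) has_real_derivative z \<bullet> D (x + s *\<^sub>R z)) (at s)"
    and "((\<lambda>s. z \<bullet> D (x + s *\<^sub>R z)) has_real_derivative z \<bullet> (H (x + s *\<^sub>R z) *v z)) (at s)"
proof -
  have f: "(f has_derivative (\<lambda>h. h \<bullet> D y)) (at y)" and D: "(D has_derivative (\<lambda>h. H y *v h)) (at y)" for y
    using assms by (auto simp: C2_on_Rn_def gderiv_def)
  have line: "((\<lambda>s. x + s *\<^sub>R z) has_derivative (\<lambda>h. h *\<^sub>R z)) (at s)"
    by (auto intro!: derivative_eq_intros)
  from has_derivative_compose[OF line f]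
  show "((\<lambda>s. f (x + s *\<^sub>R z)) has_real_derivative z \<bullet> D (x + s *\<^sub>R z)) (at s)"
    unfolding has_field_derivative_def by (simp add: mult_commute_abs)
  from has_derivative_inner_right[OF has_derivative_compose[OF line D], of z]
  show "((\<lambda>s. z \<bullet> D (x + s *\<^sub>R z)) has_real_derivative z \<bullet> (H (x + s *\<^sub>R z) *v z)) (at s)"
    unfolding has_field_derivative_def by (simp add: mult_commute_abs matrix_vector_mult_scaleR)
qed

lemma first_order_remainder_le:
  fixes f :: "real^'n \<Rightarrow> real"
  assumes C2: "C2_on_Rn f D H" and D: "\<And>x y. norm (D x - D y) \<le> B * norm (x - y)" and B: "B \<ge> 0"
  shows "\<bar>f (x + z) - f x - z \<bullet> D x\<bar> \<le> B * (norm z)\<^sup>2"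
proof -
  obtain s where s: "0 < s" "s < 1" "f (x + 1 *\<^sub>R z) - f (x + 0 *\<^sub>R z) = (1 - 0) * (z \<bullet> D (x + s *\<^sub>R z))"
    using MVT2[of 0 1 "\<lambda>s. f (x + s *\<^sub>R z)" "\<lambda>s. z \<bullet> D (x + s *\<^sub>R z)"]
      C2_on_Rn_line_derivatives(1)[OF C2] by auto
  then have "f (x + z) - f x - z \<bullet> D x = z \<bullet> (D (x + s *\<^sub>R z) - D x)"
    by (simp add: inner_diff_right)
  also have "\<bar>\<dots>\<bar> \<le> norm z * norm (D (x + s *\<^sub>R z) - D x)"
    by (rule Cauchy_Schwarz_ineq2)
  also have "\<dots> \<le> norm z * (B * norm (s *\<^sub>R z))"
    using D[of "x + s *\<^sub>R z" x] by (intro mult_left_mono) auto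
  also have "\<dots> \<le> norm z * (B * norm z)"
    using s B by (intro mult_left_mono) (auto simp: mult_left_le_one_le)
  finally show ?thesis by (simp add: power2_eq_square mult_ac)
qed

text \<open>The symmetric difference \<open>f (x + z) + f (x - z)\<close> has no first-order part, so Taylor's formula with
  second-order remainder compares it with the Hessian form at \<open>x\<close> alone. The error is cubic because
  the intermediate Hessians differ from the one at \<open>x\<close> by a multiple of \<open>norm z\<close>.\<close>

lemma second_order_remainder_le:
  fixes f :: "real^'n \<Rightarrow> real"
  assumes C2: "C2_on_Rn f D H"
    and H: "\<And>x y. \<bar>z \<bullet> (H x *v z) - z \<bullet> (H y *v z)\<bar> \<le> c * norm (x - y) * (norm z)\<^sup>2" and c: "c \<ge> 0"
  shows "\<bar>f (x + z) + f (x - z) - 2 * f x - z \<bullet> (H x *v z)\<bar> \<le> c * norm z ^ 3"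
proof -
  let ?q = "\<lambda>y. z \<bullet> (H y *v z)"
  \<comment> \<open>\<open>g m\<close> is the \<open>m\<close>-th derivative of \<open>s \<mapsto> f (x + s z) + f (x - s z)\<close>.\<close>
  define g where "g = (\<lambda>(m::nat) (s::real). if m = 0 then f (x + s *\<^sub>R z) + f (x + s *\<^sub>R (- z))
    else if m = 1 then z \<bullet> D (x + s *\<^sub>R z) + (- z) \<bullet> D (x + s *\<^sub>R (- z))
    else ?q (x + s *\<^sub>R z) + (- z) \<bullet> (H (x + s *\<^sub>R (- z)) *v (- z)))"
  have "\<exists>t. 0 < t \<and> t < 1 \<and> g 0 1 = (\<Sum>m<2::nat. g m 0 / fact m * 1 ^ m) + g 2 t / fact 2 * 1 ^ 2"
  proof (rule Maclaurin)
    show "\<forall>m t. m < 2 \<and> 0 \<le> t \<and> t \<le> 1 \<longrightarrow> (g m has_real_derivative g (Suc m) t) (at t)"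
    proof (intro allI impI)
      fix m :: nat and t :: real assume "m < 2 \<and> 0 \<le> t \<and> t \<le> 1"
      then consider "m = 0" | "m = 1" by linarith
      then show "(g m has_real_derivative g (Suc m) t) (at t)"
      proof cases
        case 1
        have "g 0 = (\<lambda>s. f (x + s *\<^sub>R z) + f (x + s *\<^sub>R (- z)))"
          "g (Suc 0) t = z \<bullet> D (x + t *\<^sub>R z) + (- z) \<bullet> D (x + t *\<^sub>R (- z))"
          by (auto simp: g_def)
        then show ?thesis
          unfolding 1 by (simp only:) (intro DERIV_add C2_on_Rn_line_derivatives[OF C2])
      next
        case 2
        have "g 1 = (\<lambda>s. z \<bullet> D (x + s *\<^sub>R z) + (- z) \<bullet> D (x + s *\<^sub>R (- z)))"
          "g (Suc 1) t = ?q (x + t *\<^sub>R z) + (- z) \<bullet> (H (x + t *\<^sub>R (- z)) *v (- z))"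
          by (auto simp: g_def)
        then show ?thesis
          unfolding 2 by (simp only:) (intro DERIV_add C2_on_Rn_line_derivatives[OF C2])
      qed
    qed
  qed auto
  then obtain t where t: "0 < t" "t < 1" "g 0 1 = g 0 0 + g 1 0 + g 2 t / 2"
    by (auto simp: numeral_2_eq_2)
  have neg: "(- z) \<bullet> (A *v (- z)) = z \<bullet> (A *v z)" for A :: "real^'n^'n"
    using matrix_vector_mult_scaleR[of A "- 1" z] by simp
  have "f (x + z) + f (x - z) - 2 * f x - ?q x
      = ((?q (x + t *\<^sub>R z) - ?q x) + (?q (x - t *\<^sub>R z) - ?q x)) / 2"
    using t(3) unfolding g_def neg by (simp add: field_simps)
  also have "\<bar>\<dots>\<bar> \<le> c * norm z * (norm z)\<^sup>2"
  proof -
    have b: "\<bar>?q (x + w) - ?q x\<bar> \<le> c * norm z * (norm z)\<^sup>2" if "norm w = t * norm z" for w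
    proof -
      have "\<bar>?q (x + w) - ?q x\<bar> \<le> c * (t * norm z) * (norm z)\<^sup>2"
        using H[of "x + w" x] that by simp
      also have "\<dots> \<le> c * norm z * (norm z)\<^sup>2"
        using t c by (intro mult_right_mono mult_left_mono) (auto simp: mult_left_le_one_le)
      finally show ?thesis .
    qed
    show ?thesis
      using b[of "t *\<^sub>R z"] b[of "- (t *\<^sub>R z)"] t by simp
  qed
  finally show ?thesis by (simp add: power2_eq_square power3_eq_cube mult_ac)
qed

section \<open>Smoothing Lipschitz functions\<close>

text \<open>Writing the average with \<open>x + t\<close> under \<open>F\<close> makes the transfer of the Lipschitz property of
  \<open>F\<close> immediate. The cube is any fixed set containing the support of the kernel.\<close>

definition conv :: "('a::euclidean_space \<Rightarrow> real) \<Rightarrow> ('a \<Rightarrow> 'b) \<Rightarrow> 'a \<Rightarrow> 'b::euclidean_space" where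
  "conv F k x = integral (cbox (- One) One) (\<lambda>t. F (x + t) *\<^sub>R k t)"

lemma conv_integrable:
  fixes F :: "'a::euclidean_space \<Rightarrow> real" and k :: "'a \<Rightarrow> 'b::banach"
  assumes "continuous_on UNIV F" "continuous_on UNIV k"
  shows "(\<lambda>t. F (x + t) *\<^sub>R k t) integrable_on cbox a b"
proof (intro integrable_continuous continuous_on_scaleR)
  show "continuous_on (cbox a b) (\<lambda>t. F (x + t))"
    by (rule continuous_on_compose2[OF assms(1)]) (auto intro!: continuous_intros)
  show "continuous_on (cbox a b) k"
    using assms(2) continuous_on_subset by blast
qed

lemma conv_linear:
  fixes F :: "'a::euclidean_space \<Rightarrow> real" and k :: "'a \<Rightarrow> 'b::euclidean_space" and g :: "'b \<Rightarrow> 'c::euclidean_space"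
  assumes "continuous_on UNIV F" "continuous_on UNIV k" "bounded_linear g"
  shows "conv F (\<lambda>t. g (k t)) x = g (conv F k x)"
  using integral_linear[OF conv_integrable[OF assms(1,2)] assms(3)]
  by (simp add: conv_def o_def linear_simps[OF assms(3)])

text \<open>After the substitution \<open>s = x + t\<close> the variable \<open>x\<close> occurs only in the smooth kernel; for \<open>x\<close>
  near \<open>x0\<close> the domain of integration can be kept fixed, as the kernel vanishes outside the cube.\<close>

lemma conv_eq_fixed_domain:
  fixes k :: "'a::euclidean_space \<Rightarrow> 'b::banach"
  assumes "continuous_on UNIV F" "continuous_on UNIV k"
    and k0: "\<And>t. t \<notin> cbox (- One) One \<Longrightarrow> k t = 0"
    and x: "x \<in> cbox (x0 - One) (x0 + One)"
  shows "integral (cbox (- One) One) (\<lambda>t. F (x + t) *\<^sub>R k t)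
    = integral (cbox (x0 - 2 *\<^sub>R One) (x0 + 2 *\<^sub>R One)) (\<lambda>s. F s *\<^sub>R k (s - x))"
proof -
  let ?f = "\<lambda>s. F s *\<^sub>R k (s - x)"
  have "?f integrable_on cbox (x - One) (x + One)"
  proof (intro integrable_continuous continuous_on_scaleR)
    show "continuous_on (cbox (x - One) (x + One)) F"
      using assms(1) continuous_on_subset by blast
    show "continuous_on (cbox (x - One) (x + One)) (\<lambda>s. k (s - x))"
      by (rule continuous_on_compose2[OF assms(2)]) (auto intro!: continuous_intros)
  qed
  then have 1: "(?f has_integral integral (cbox (x - One) (x + One)) ?f) (cbox (x - One) (x + One))"
    by (rule integrable_integral)
  have "(?f has_integral integral (cbox (x - One) (x + One)) ?f) (cbox (x0 - 2 *\<^sub>R One) (x0 + 2 *\<^sub>R One))"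
  proof (rule has_integral_on_superset[OF 1])
    fix s assume "s \<notin> cbox (x - One) (x + One)"
    then have "s - x \<notin> cbox (- One) One"
      by (auto simp: mem_box algebra_simps)
    then show "?f s = 0" by (simp add: k0)
  next
    show "cbox (x - One) (x + One) \<subseteq> cbox (x0 - 2 *\<^sub>R One) (x0 + 2 *\<^sub>R One)"
      using x by (fastforce simp: mem_box algebra_simps)
  qed
  then have "integral (cbox (x0 - 2 *\<^sub>R One) (x0 + 2 *\<^sub>R One)) ?f = integral (cbox (x - One) (x + One)) ?f"
    by (rule integral_unique)
  then show ?thesis
    using integral_shift_cbox[of "x - One" x "x + One" ?f] by (simp add: add.commute)
qed

text \<open>Differentiation falls on the kernel, with a minus sign because the kernel is evaluated at \<open>s - x\<close>
  after the substitution. The derivative is again an average of the same kind, so the lemma can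
  be applied repeatedly.\<close>

lemma conv_has_derivative:
  fixes F :: "'a::euclidean_space \<Rightarrow> real" and k :: "'a \<Rightarrow> 'b::euclidean_space"
  assumes F: "continuous_on UNIV F"
    and k: "\<And>t. (k has_derivative k' t) (at t)"
    and k': "\<And>h. continuous_on UNIV (\<lambda>t. k' t h)"
    and k0: "\<And>t. t \<notin> cbox (- One) One \<Longrightarrow> k t = 0"
    and k'0: "\<And>t h. t \<notin> cbox (- One) One \<Longrightarrow> k' t h = 0"
  shows "(conv F k has_derivative (\<lambda>h. - conv F (\<lambda>t. k' t h) x0)) (at x0)"
proof -
  let ?U = "cbox (x0 - One) (x0 + One)" and ?Q = "cbox (x0 - 2 *\<^sub>R One) (x0 + 2 *\<^sub>R One)"
  define B where "B = (\<lambda>t. Blinfun (k' t))"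
  have B: "blinfun_apply (B t) = k' t" for t
    using has_derivative_bounded_linear[OF k] by (simp add: B_def bounded_linear_Blinfun_apply)
  have contB: "continuous_on UNIV B"
    by (rule continuous_on_blinfun_componentwise) (simp add: B k')
  have contk: "continuous_on UNIV k"
    using k has_derivative_continuous_on[of UNIV k k'] has_derivative_at_withinI by blast
  have x0: "x0 \<in> box (x0 - One) (x0 + One)"
    by (auto simp: mem_box algebra_simps)
  have deriv: "((\<lambda>x. integral ?Q (\<lambda>s. F s *\<^sub>R k (s - x))) has_derivative
      integral ?Q (\<lambda>s. - (F s *\<^sub>R B (s - x0)))) (at x0 within ?U)"
  proof (rule leibniz_rule)
    fix x s
    have "((\<lambda>x. s - x) has_derivative (\<lambda>h. - h)) (at x within ?U)"
      by (auto intro!: derivative_eq_intros)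
    from has_derivative_compose[OF this k]
    have "((\<lambda>x. F s *\<^sub>R k (s - x)) has_derivative (\<lambda>h. F s *\<^sub>R k' (s - x) (- h))) (at x within ?U)"
      by (rule has_derivative_scaleR_right)
    then show "((\<lambda>x. F s *\<^sub>R k (s - x)) has_derivative blinfun_apply (- (F s *\<^sub>R B (s - x)))) (at x within ?U)"
      by (simp add: B[symmetric] blinfun.bilinear_simps uminus_blinfun.rep_eq scaleR_blinfun.rep_eq)
  next
    fix x
    show "(\<lambda>s. F s *\<^sub>R k (s - x)) integrable_on ?Q"
    proof (intro integrable_continuous continuous_on_scaleR)
      show "continuous_on ?Q F" using F continuous_on_subset by blast
      show "continuous_on ?Q (\<lambda>s. k (s - x))"
        by (rule continuous_on_compose2[OF contk]) (auto intro!: continuous_intros)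
    qed
  next
    show "continuous_on (?U \<times> ?Q) (\<lambda>(x, s). - (F s *\<^sub>R B (s - x)))"
      unfolding case_prod_unfold
    proof (intro continuous_on_minus continuous_on_scaleR)
      show "continuous_on (?U \<times> ?Q) (\<lambda>p. F (snd p))"
        by (rule continuous_on_compose2[OF F]) (auto intro!: continuous_intros)
      show "continuous_on (?U \<times> ?Q) (\<lambda>p. B (snd p - fst p))"
        by (rule continuous_on_compose2[OF contB]) (auto intro!: continuous_intros)
    qed
  qed (use x0 box_subset_cbox in \<open>auto simp: convex_box\<close>)
  have domain: "integral ?Q (\<lambda>s. - (F s *\<^sub>R B (s - x0))) = - integral (cbox (- One) One) (\<lambda>t. F (x0 + t) *\<^sub>R B t)"
  proof -
    have "B t = 0" if "t \<notin> cbox (- One) One" for t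
      using k'0[OF that] by (intro blinfun_eqI) (simp add: B)
    then show ?thesis
      using conv_eq_fixed_domain[OF F contB, of x0 x0] x0 box_subset_cbox[of "x0 - One" "x0 + One"]
      by (simp add: integral_neg subset_iff)
  qed
  have apply_h: "blinfun_apply (- integral (cbox (- One) One) (\<lambda>t. F (x0 + t) *\<^sub>R B t)) h
      = - conv F (\<lambda>t. k' t h) x0" for h
  proof -
    have "(\<lambda>t. F (x0 + t) *\<^sub>R B t) integrable_on cbox (- One) One"
    proof (intro integrable_continuous continuous_on_scaleR)
      show "continuous_on (cbox (- One) One) (\<lambda>t. F (x0 + t))"
        by (rule continuous_on_compose2[OF F]) (auto intro!: continuous_intros)
      show "continuous_on (cbox (- One) One) B"
        using contB continuous_on_subset by blast
    qed
    from integral_linear[OF this, of "\<lambda>b. blinfun_apply b h"] show ?thesis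
      by (simp add: conv_def o_def blinfun.bounded_linear_left B[symmetric] blinfun.bilinear_simps)
  qed
  have "blinfun_apply (integral ?Q (\<lambda>s. - (F s *\<^sub>R B (s - x0)))) = (\<lambda>h. - conv F (\<lambda>t. k' t h) x0)"
    unfolding domain by (rule ext) (rule apply_h)
  with deriv have "((\<lambda>x. integral ?Q (\<lambda>s. F s *\<^sub>R k (s - x))) has_derivative
      (\<lambda>h. - conv F (\<lambda>t. k' t h) x0)) (at x0 within ?U)"
    by (simp only:)
  then have "(conv F k has_derivative (\<lambda>h. - conv F (\<lambda>t. k' t h) x0)) (at x0 within ?U)"
    by (rule has_derivative_transform[rotated 2])
      (use x0 box_subset_cbox[of "x0 - One" "x0 + One"] conv_eq_fixed_domain[OF F contk k0] in
        \<open>auto simp: conv_def\<close>)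
  moreover have "at x0 within ?U = at x0"
    using x0 interior_cbox by (intro at_within_interior) auto
  ultimately show ?thesis by simp
qed

text \<open>Applied to a derivative of the kernel, this bounds the modulus of continuity of the corresponding derivative
  of the average, although \<open>F\<close> itself is only Lipschitz.\<close>

lemma conv_lipschitz:
  fixes F :: "'a::euclidean_space \<Rightarrow> real" and k :: "'a \<Rightarrow> 'b::euclidean_space"
  assumes F: "\<And>x y. \<bar>F x - F y\<bar> \<le> L * norm (x - y)"
    and cont: "continuous_on UNIV F" "continuous_on UNIV k"
    and M: "\<And>t. norm (k t) \<le> M" and M0: "M \<ge> 0" and L: "L \<ge> 0"
  shows "norm (conv F k x - conv F k y) \<le> L * M * measure lborel (cbox (- One) (One :: 'a)) * norm (x - y)"
proof -
  have "conv F k x - conv F k y = integral (cbox (- One) One) (\<lambda>t. F (x + t) *\<^sub>R k t - F (y + t) *\<^sub>R k t)"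
    unfolding conv_def by (rule integral_diff[symmetric]; rule conv_integrable[OF cont])
  also have "norm \<dots> \<le> L * norm (x - y) * M * measure lborel (cbox (- One) (One :: 'a))"
  proof (rule integrable_bound)
    show "0 \<le> L * norm (x - y) * M" using M0 L by simp
    show "(\<lambda>t. F (x + t) *\<^sub>R k t - F (y + t) *\<^sub>R k t) integrable_on cbox (- One) One"
      by (intro integrable_diff conv_integrable[OF cont])
    fix t
    have "norm (F (x + t) *\<^sub>R k t - F (y + t) *\<^sub>R k t) = \<bar>F (x + t) - F (y + t)\<bar> * norm (k t)"
      by (simp flip: scaleR_left_diff_distrib)
    also have "\<dots> \<le> L * norm (x - y) * M"
      using F[of "x + t" "y + t"] M[of t] L by (intro mult_mono) auto
    finally show "norm (F (x + t) *\<^sub>R k t - F (y + t) *\<^sub>R k t) \<le> L * norm (x - y) * M" .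
  qed
  finally show ?thesis by (simp add: algebra_simps)
qed

lemma has_real_derivative_max_0_power:
  "((\<lambda>s. max 0 s ^ Suc (Suc n)) has_real_derivative real (Suc (Suc n)) * max 0 s ^ Suc n) (at s)"
proof -
  consider "s > 0" | "s < 0" | "s = 0" by linarith
  then show ?thesis
  proof cases
    case 1
    have "((\<lambda>s. s ^ Suc (Suc n)) has_real_derivative real (Suc (Suc n)) * max 0 s ^ Suc n) (at s)"
      using DERIV_pow[of "Suc (Suc n)" s] 1 by (simp add: max_def)
    then show ?thesis
      by (rule has_field_derivative_transform_within_open[of _ _ _ "{0<..}"]) (use 1 in \<open>auto simp: max_def\<close>)
  next
    case 2
    have "((\<lambda>s. 0) has_real_derivative real (Suc (Suc n)) * max 0 s ^ Suc n) (at s)"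
      using 2 by (simp add: max_def)
    then show ?thesis
      by (rule has_field_derivative_transform_within_open[of _ _ _ "{..<0}"]) (use 2 in \<open>auto simp: max_def\<close>)
  next
    case 3
    have "((\<lambda>t. max 0 t ^ Suc (Suc n) / t) \<longlongrightarrow> (0::real)) (at 0)"
    proof (rule Lim_null_comparison)
      show "\<forall>\<^sub>F t in at 0. norm (max 0 t ^ Suc (Suc n) / t) \<le> \<bar>t::real\<bar> ^ Suc n"
        by (intro always_eventually) (auto simp: max_def mult_nonpos_nonneg)
      show "((\<lambda>t::real. \<bar>t\<bar> ^ Suc n) \<longlongrightarrow> 0) (at 0)"
        by (auto intro!: tendsto_eq_intros)
    qed
    then show ?thesis
      using 3 by (simp add: DERIV_def)
  qed
qed

text \<open>A kernel supported in the ball of radius \<open>r\<close>; the third power is the least integer power for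
  which it is of class C^2. \<open>Dbump\<close> and \<open>D2bump\<close> are its gradient and Hessian.\<close>

definition bump :: "real \<Rightarrow> real^'n \<Rightarrow> real" where
  "bump r t = max 0 (r\<^sup>2 - t \<bullet> t) ^ 3"

definition Dbump :: "real \<Rightarrow> real^'n \<Rightarrow> real^'n" where
  "Dbump r t = (- 6 * max 0 (r\<^sup>2 - t \<bullet> t) ^ 2) *\<^sub>R t"

definition D2bump :: "real \<Rightarrow> real^'n \<Rightarrow> real^'n^'n" where
  "D2bump r t = (- 6 * max 0 (r\<^sup>2 - t \<bullet> t) ^ 2) *\<^sub>R mat 1
     + (24 * max 0 (r\<^sup>2 - t \<bullet> t)) *\<^sub>R (\<chi> i j. t $ i * t $ j)"

lemma rank_one_mult: "(\<chi> i j. t $ i * t $ j) *v h = (t \<bullet> h) *\<^sub>R (t :: real^'n)"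
  by (simp add: vec_eq_iff matrix_vector_mult_def inner_vec_def sum_distrib_left sum_distrib_right mult_ac)

lemma D2bump_mult:
  "D2bump r t *v h = (- 6 * max 0 (r\<^sup>2 - t \<bullet> t) ^ 2) *\<^sub>R h + (24 * max 0 (r\<^sup>2 - t \<bullet> t) * (t \<bullet> h)) *\<^sub>R t"
  unfolding D2bump_def mult_add_matrix mult_scaleR_matrix rank_one_mult by simp

lemma has_derivative_radius: "((\<lambda>t. r\<^sup>2 - t \<bullet> t) has_derivative (\<lambda>h. - 2 * (t \<bullet> h))) (at t)"
  for t :: "real^'n"
proof -
  have "((\<lambda>t. r\<^sup>2 - t \<bullet> t) has_derivative (\<lambda>h. 0 - (t \<bullet> h + h \<bullet> t))) (at t)"
    by (intro has_derivative_diff has_derivative_const has_derivative_inner has_derivative_ident)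
  then show ?thesis by (simp add: inner_commute)
qed

lemma bump_has_derivative: "(bump r has_derivative (\<lambda>h. h \<bullet> Dbump r t)) (at t)"
proof -
  have "((\<lambda>s. max 0 s ^ 3) has_derivative (\<lambda>h. (3 * max 0 (r\<^sup>2 - t \<bullet> t) ^ 2) * h)) (at (r\<^sup>2 - t \<bullet> t))"
    using has_real_derivative_max_0_power[of 1 "r\<^sup>2 - t \<bullet> t"]
    by (simp add: has_field_derivative_def numeral_3_eq_3 numeral_2_eq_2)
  from has_derivative_compose[OF has_derivative_radius this]
  show ?thesis
    by (simp add: bump_def[abs_def] Dbump_def inner_commute mult_ac)
qed

lemma Dbump_has_derivative: "(Dbump r has_derivative (\<lambda>h. D2bump r t *v h)) (at t)"
proof -
  have "((\<lambda>s. max 0 s ^ 2) has_derivative (\<lambda>h. (2 * max 0 (r\<^sup>2 - t \<bullet> t)) * h)) (at (r\<^sup>2 - t \<bullet> t))"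
    using has_real_derivative_max_0_power[of 0 "r\<^sup>2 - t \<bullet> t"]
    by (simp add: has_field_derivative_def numeral_2_eq_2)
  from has_derivative_scaleR[OF has_derivative_mult_right[OF has_derivative_compose[OF has_derivative_radius this], of "- 6"]
      has_derivative_ident]
  show ?thesis
    by (simp add: Dbump_def[abs_def] D2bump_mult[abs_def] mult_ac add.commute)
qed

lemma continuous_on_D2bump: "continuous_on UNIV (D2bump r)"
  unfolding D2bump_def[abs_def]
  by (intro continuous_intros continuous_on_vec_lambda)

lemma bump_eq_0:
  assumes "0 < r" "norm t \<ge> r"
  shows "bump r t = 0" "Dbump r t = 0" "D2bump r t = 0"
proof -
  have "r\<^sup>2 \<le> t \<bullet> t"
    using power_mono[OF assms(2), of 2] assms(1) by (simp add: power2_norm_eq_inner)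
  then show "bump r t = 0" "Dbump r t = 0" "D2bump r t = 0"
    by (auto simp: bump_def Dbump_def D2bump_def)
qed

lemma not_in_cube:
  assumes "t \<notin> cbox (- One) (One :: 'a::euclidean_space)"
  shows "norm t \<ge> 1"
proof -
  obtain b where "b \<in> Basis" "\<bar>t \<bullet> b\<bar> > 1"
    using assms by (auto simp: mem_box abs_le_iff not_le)
  then show ?thesis
    using Basis_le_norm[of b t] by simp
qed

lemma compactly_supported_bounded:
  fixes k :: "'a::euclidean_space \<Rightarrow> 'b::euclidean_space"
  assumes "continuous_on UNIV k" and k0: "\<And>t. t \<notin> cbox (- One) One \<Longrightarrow> k t = 0"
  obtains M where "M \<ge> 0" "\<And>t. norm (k t) \<le> M"
proof -
  have "bounded (k ` cbox (- One) One)"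
    using assms(1) continuous_on_subset by (intro compact_imp_bounded compact_continuous_image) auto
  then obtain M where M: "M > 0" "\<And>t. t \<in> cbox (- One) One \<Longrightarrow> norm (k t) \<le> M"
    unfolding bounded_pos by auto
  show thesis
  proof (rule that)
    show "norm (k t) \<le> M" for t
      using M k0[of t] by (cases "t \<in> cbox (- One) One") auto
  qed (use M in simp)
qed

lemma bounded_bilinear_matrix_vector_mult:
  "bounded_bilinear (\<lambda>(A :: real^'n^'n) x. A *v x)"
  unfolding bilinear_conv_bounded_bilinear[symmetric] bilinear_def
  by (auto simp: linear_iff mult_add_matrix mult_scaleR_matrix matrix_vector_right_distrib matrix_vector_mult_scaleR)

text \<open>The normalised average of \<open>F\<close> against \<open>bump r\<close> inherits the constant \<open>L\<close> exactly, since it is a convex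
  combination of translates of \<open>F\<close>; it moves the values by at most \<open>L * r\<close>, since only points at
  distance less than \<open>r\<close> enter. Its gradient and Hessian are averages against derivatives of the kernel, hence
  Lipschitz, which gives the two Taylor bounds. Their constants depend on \<open>r\<close>, which does no harm:
  \<open>r\<close> is chosen before the time step.\<close>

lemma lipschitz_mollification:
  fixes F :: "real^'n \<Rightarrow> real"
  assumes F: "\<And>x y. \<bar>F x - F y\<bar> \<le> L * norm (x - y)" and L: "L \<ge> 0" and r: "0 < r" "r \<le> 1"
  obtains f Df Hf B c where "C2_on_Rn f Df Hf"
    and "\<And>x z. \<bar>f (x + z) - f x\<bar> \<le> L * norm z"
    and "B \<ge> 0" "\<And>x z. \<bar>f (x + z) - f x - z \<bullet> Df x\<bar> \<le> B * (norm z)\<^sup>2"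
    and "c \<ge> 0" "\<And>x z. \<bar>f (x + z) + f (x - z) - 2 * f x - z \<bullet> (Hf x *v z)\<bar> \<le> c * norm z ^ 3"
    and "\<And>x. \<bar>f x - F x\<bar> \<le> L * r"
proof -
  let ?Q = "cbox (- One) One :: (real^'n) set"
  have contF: "continuous_on UNIV F"
    by (rule lipschitz_on_continuous_on[of L]) (use F L in \<open>auto intro!: lipschitz_onI simp: dist_norm\<close>)
  have cont: "continuous_on UNIV (bump r :: real^'n \<Rightarrow> real)" "continuous_on UNIV (Dbump r :: real^'n \<Rightarrow> _)"
      "continuous_on UNIV (D2bump r :: real^'n \<Rightarrow> _)"
    using has_derivative_continuous_on[OF has_derivative_at_withinI[OF bump_has_derivative]]
      has_derivative_continuous_on[OF has_derivative_at_withinI[OF Dbump_has_derivative]]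
      continuous_on_D2bump by blast+
  have supp: "bump r t = 0" "Dbump r t = 0" "D2bump r t = 0" if "t \<notin> ?Q" for t :: "real^'n"
    using bump_eq_0[OF r(1), of t] not_in_cube[OF that] r by auto
  obtain M1 where M1: "M1 \<ge> 0" "\<And>t :: real^'n. norm (Dbump r t) \<le> M1"
    using compactly_supported_bounded[OF cont(2) supp(2)] by blast
  obtain M2 where M2: "M2 \<ge> 0" "\<And>t :: real^'n. norm (D2bump r t) \<le> M2"
    using compactly_supported_bounded[OF cont(3) supp(3)] by blast
  obtain K where K: "K \<ge> 0" "\<And>(A :: real^'n^'n) x. norm (A *v x) \<le> norm A * norm x * K"
    using bounded_bilinear.nonneg_bounded[OF bounded_bilinear_matrix_vector_mult] by blast
  have bump_nonneg: "bump r t \<ge> 0" for t :: "real^'n" by (simp add: bump_def)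
  have bump_int: "bump r integrable_on ?Q"
    using cont(1) continuous_on_subset by (intro integrable_continuous) auto
  define I where "I = integral ?Q (bump r)"
  have I: "I > 0"
  proof -
    have "I \<ge> 0" unfolding I_def by (intro integral_nonneg bump_int bump_nonneg)
    moreover have "I \<noteq> 0"
    proof
      assume "I = 0"
      moreover have "0 \<in> box (- One) (One :: real^'n)" by (auto simp: mem_box)
      moreover have "continuous_on ?Q (bump r)"
        using cont(1) by (rule continuous_on_subset) simp
      ultimately have "\<forall>t\<in>?Q. bump r t = 0"
        unfolding I_def by (subst (asm) integral_cbox_eq_0_iff) (auto simp: bump_nonneg)
      moreover have "0 \<in> ?Q" by (auto simp: mem_box)
      ultimately have "bump r (0 :: real^'n) = 0" by blast
      then show False using r by (simp add: bump_def)
    qed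
    ultimately show ?thesis by simp
  qed
  have D0: "(conv F (bump r) has_derivative (\<lambda>h. - (h \<bullet> conv F (Dbump r) x))) (at x)" for x :: "real^'n"
    using conv_has_derivative[OF contF bump_has_derivative, of r x] cont(2) supp
      conv_linear[OF contF cont(2) bounded_linear_inner_right]
    by (simp add: continuous_on_inner[OF continuous_on_const])
  have D1: "(conv F (Dbump r) has_derivative (\<lambda>h. - (conv F (D2bump r) x *v h))) (at x)" for x :: "real^'n"
    using conv_has_derivative[OF contF Dbump_has_derivative, of r x] cont(3) supp
      conv_linear[OF contF cont(3) bounded_bilinear.bounded_linear_left[OF bounded_bilinear_matrix_vector_mult]]
      bounded_bilinear.continuous_on[OF bounded_bilinear_matrix_vector_mult cont(3) continuous_on_const]
    by simp
  define m where "m = measure lborel ?Q"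
  have m: "m \<ge> 0" unfolding m_def by (rule measure_nonneg)
  have Lip1: "norm (conv F (Dbump r) x - conv F (Dbump r) y) \<le> L * M1 * m * norm (x - y)" for x y :: "real^'n"
    unfolding m_def by (rule conv_lipschitz[OF F contF cont(2) M1(2) M1(1) L])
  have Lip2: "norm (conv F (D2bump r) x - conv F (D2bump r) y) \<le> L * M2 * m * norm (x - y)" for x y :: "real^'n"
    unfolding m_def by (rule conv_lipschitz[OF F contF cont(3) M2(2) M2(1) L])
  let ?f = "\<lambda>x. (1 / I) * conv F (bump r) x" and ?D = "\<lambda>x. (1 / I) *\<^sub>R (- conv F (Dbump r) x)"
    and ?H = "\<lambda>x. (1 / I) *\<^sub>R conv F (D2bump r) x"
  have "C2_on_Rn (conv F (bump r)) (\<lambda>x. - conv F (Dbump r) x) (conv F (D2bump r))"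
  proof -
    have "continuous_on UNIV (conv F (D2bump r))"
      by (rule lipschitz_on_continuous_on[of "L * M2 * m"])
        (use Lip2 L M2 m in \<open>auto intro!: lipschitz_onI simp: dist_norm\<close>)
    moreover have "((\<lambda>x. - conv F (Dbump r) x) has_derivative (\<lambda>h. conv F (D2bump r) x *v h)) (at x)" for x
      using has_derivative_minus[OF D1[of x]] by simp
    ultimately show ?thesis
      using D0 by (simp add: C2_on_Rn_def gderiv_def)
  qed
  then have C2: "C2_on_Rn ?f ?D ?H" by (rule C2_on_Rn_scaleR)
  have avg: "\<bar>integral ?Q (\<lambda>t. g t *\<^sub>R bump r t)\<bar> \<le> a * I"
    if "continuous_on UNIV g" "\<And>t. norm t < r \<Longrightarrow> \<bar>g t\<bar> \<le> a" for g and a :: real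
  proof -
    have "norm (integral ?Q (\<lambda>t. g t *\<^sub>R bump r t)) \<le> integral ?Q (\<lambda>t. a * bump r t)"
    proof (rule integral_norm_bound_integral)
      show "(\<lambda>t. g t *\<^sub>R bump r t) integrable_on ?Q"
        using conv_integrable[OF that(1) cont(1), of 0] by simp
      show "(\<lambda>t. a * bump r t) integrable_on ?Q"
        using bump_int by (rule integrable_on_mult_right)
      show "norm (g t *\<^sub>R bump r t) \<le> a * bump r t" for t
        using that(2)[of t] bump_eq_0(1)[OF r(1), of t] bump_nonneg[of t]
        by (cases "norm t < r") (auto simp: abs_mult intro!: mult_right_mono)
    qed
    then show ?thesis by (simp add: I_def)
  qed
  have contT: "continuous_on UNIV (\<lambda>t. F (x + t))" for x
    by (rule continuous_on_compose2[OF contF]) (auto intro!: continuous_intros)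
  show thesis
  proof (rule that)
    show "C2_on_Rn ?f ?D ?H" by (rule C2)
    show "\<bar>?f (x + z) - ?f x\<bar> \<le> L * norm z" for x z
    proof -
      have "conv F (bump r) (x + z) - conv F (bump r) x = integral ?Q (\<lambda>t. (F (x + z + t) - F (x + t)) *\<^sub>R bump r t)"
        unfolding conv_def scaleR_left_diff_distrib
        by (rule integral_diff[symmetric]; rule conv_integrable[OF contF cont(1)])
      also have "\<bar>\<dots>\<bar> \<le> L * norm z * I"
      proof (rule avg)
        show "continuous_on UNIV (\<lambda>t. F (x + z + t) - F (x + t))"
          by (intro continuous_on_diff contT)
        show "\<bar>F (x + z + t) - F (x + t)\<bar> \<le> L * norm z" for t
          using F[of "x + z + t" "x + t"] by simp
      qed
      finally have "\<bar>conv F (bump r) (x + z) - conv F (bump r) x\<bar> / I \<le> L * norm z"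
        using I by (simp add: pos_divide_le_eq)
      then show ?thesis using I by (simp flip: diff_divide_distrib)
    qed
    show "\<bar>?f x - F x\<bar> \<le> L * r" for x
    proof -
      have "F x * I = integral ?Q (\<lambda>t. F x *\<^sub>R bump r t)"
        by (simp add: I_def)
      then have "conv F (bump r) x - F x * I = integral ?Q (\<lambda>t. (F (x + t) - F x) *\<^sub>R bump r t)"
        unfolding conv_def scaleR_left_diff_distrib
        using integral_diff[OF conv_integrable[OF contF cont(1), of x "- One" One] integrable_cmul[OF bump_int, of "F x"]]
        by simp
      also have "\<bar>\<dots>\<bar> \<le> L * r * I"
      proof (rule avg)
        show "continuous_on UNIV (\<lambda>t. F (x + t) - F x)"
          by (intro continuous_on_diff contT continuous_on_const)
        show "\<bar>F (x + t) - F x\<bar> \<le> L * r" if "norm t < r" for t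
          using F[of "x + t" x] mult_left_mono[of "norm t" r L] that L by simp
      qed
      finally have "\<bar>conv F (bump r) x - F x * I\<bar> / I \<le> L * r"
        using I by (simp add: pos_divide_le_eq)
      moreover have "?f x - F x = (conv F (bump r) x - F x * I) / I"
        using I by (simp add: field_simps)
      ultimately show ?thesis using I by simp
    qed
    show B0: "L * M1 * m / I \<ge> 0" using L M1 m I by simp
    show "\<bar>?f (x + z) - ?f x - z \<bullet> ?D x\<bar> \<le> L * M1 * m / I * (norm z)\<^sup>2" for x z
    proof (rule first_order_remainder_le[OF C2 _ B0])
      fix x y
      have "?D x - ?D y = (1 / I) *\<^sub>R (conv F (Dbump r) y - conv F (Dbump r) x)"
        by (simp add: algebra_simps)
      then show "norm (?D x - ?D y) \<le> L * M1 * m / I * norm (x - y)"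
        using Lip1[of y x] I by (simp add: divide_right_mono norm_minus_commute)
    qed
    show c0: "K * (L * M2 * m) / I \<ge> 0" using K L M2 m I by simp
    show "\<bar>?f (x + z) + ?f (x - z) - 2 * ?f x - z \<bullet> (?H x *v z)\<bar> \<le> K * (L * M2 * m) / I * norm z ^ 3" for x z
    proof (rule second_order_remainder_le[OF C2 _ c0])
      fix x y
      let ?A = "conv F (D2bump r) x - conv F (D2bump r) y"
      have "z \<bullet> (?H x *v z) - z \<bullet> (?H y *v z) = (1 / I) * (z \<bullet> (?A *v z))"
        unfolding mult_scaleR_matrix by (simp add: inner_diff_right matrix_vector_mult_diff_rdistrib diff_divide_distrib)
      also have "\<bar>\<dots>\<bar> \<le> (1 / I) * (norm z * (L * M2 * m * norm (x - y) * norm z * K))"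
      proof -
        have "\<bar>z \<bullet> (?A *v z)\<bar> \<le> norm z * norm (?A *v z)"
          by (rule Cauchy_Schwarz_ineq2)
        also have "\<dots> \<le> norm z * (L * M2 * m * norm (x - y) * norm z * K)"
          by (intro mult_left_mono order_trans[OF K(2)] mult_right_mono Lip2) (use K in auto)
        finally show ?thesis using I by (simp add: abs_mult divide_right_mono)
      qed
      finally show "\<bar>z \<bullet> (?H x *v z) - z \<bullet> (?H y *v z)\<bar> \<le> K * (L * M2 * m) / I * norm (x - y) * (norm z)\<^sup>2"
        by (simp add: power2_eq_square mult_ac)
    qed
  qed
qed

section \<open>The random step\<close>

text \<open>The expectation over the random parameters \<open>(\<kappa>, a, b)\<close> of one step of length \<open>h\<close>: with probability
  \<open>1/2\<close> a move along the drift for time \<open>\<kappa> = 2 h\<close>, otherwise a move by \<open>\<plusminus> sqrt (8 h)\<close> along one of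
  the two columns of \<open>\<sigma>\<close>. Drift and noise are never combined in one step, so that all Taylor expansions below are
  taken at the same point \<open>x\<close>. The size \<open>sqrt (8 h)\<close> is dictated by the second moments:
  \<open>1/8 * 2 * 8 h / 2 = h\<close> for each column.\<close>

definition mean :: "real \<Rightarrow> (real \<Rightarrow> real \<Rightarrow> real \<Rightarrow> 'a) \<Rightarrow> 'a::real_vector" where
  "mean h g = (1/2) *\<^sub>R g (2 * h) 0 0 +
     (1/8) *\<^sub>R (g 0 (sqrt (8 * h)) 0 + g 0 (- sqrt (8 * h)) 0 + g 0 0 (sqrt (8 * h)) + g 0 0 (- sqrt (8 * h)))"

lemma mean_const: "mean h (\<lambda>\<kappa> a b. c) = (c::real)"
  by (simp add: mean_def)

lemma mean_add:
  "mean h (\<lambda>\<kappa> a b. f \<kappa> a b + g \<kappa> a b) = mean h f + mean h g"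
  by (simp add: mean_def algebra_simps)

lemma mean_mult_left: "mean h (\<lambda>\<kappa> a b. c * f \<kappa> a b) = c * (mean h f :: real)"
  by (simp add: mean_def algebra_simps)

lemma mean_diff:
  "mean h (\<lambda>\<kappa> a b. f \<kappa> a b - g \<kappa> a b) = mean h f - mean h g"
  by (simp add: mean_def algebra_simps)

lemma mean_mono:
  fixes f g :: "real \<Rightarrow> real \<Rightarrow> real \<Rightarrow> real"
  assumes "\<And>\<kappa> a b. f \<kappa> a b \<le> g \<kappa> a b"
  shows "mean h f \<le> mean h g"
  unfolding mean_def real_scaleR_def by (intro add_mono mult_left_mono assms) auto

lemma abs_mean_le:
  fixes f g :: "real \<Rightarrow> real \<Rightarrow> real \<Rightarrow> real"
  assumes "\<And>\<kappa> a b. \<bar>f \<kappa> a b\<bar> \<le> g \<kappa> a b"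
  shows "\<bar>mean h f\<bar> \<le> mean h g"
  using mean_mono[of f g h] mean_mono[of "\<lambda>\<kappa> a b. - 1 * f \<kappa> a b" g h] assms
  unfolding mean_mult_left by (smt (verit))

lemma norm_square_3: "(norm z)\<^sup>2 = (z$1)\<^sup>2 + (z$2)\<^sup>2 + (z$3)\<^sup>2" for z :: "real^3"
  unfolding power2_norm_eq_inner inner_vec_def sum_3 by (simp add: power2_eq_square)

locale ornstein_uhlenbeck =
  fixes k1 k2 k3 :: real
  assumes k1: "k1 > 4" and k2: "k2 > 4" and k3: "k3 > 0"
begin

text \<open>The step with parameters \<open>(\<kappa>, a, b)\<close> sends \<open>x\<close> to \<open>x + \<kappa> b(x) + \<sigma>(x) (a, b)\<close>. This is an affine map,
  because \<open>\<sigma>\<close> depends linearly on the position; \<open>lin\<close> is its linear part and \<open>shift\<close> its value at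
  the origin. Two copies driven by the same parameters have a difference that is moved by \<open>lin\<close>.\<close>

definition lin :: "real \<Rightarrow> real \<Rightarrow> real \<Rightarrow> real^3^3" where
  "lin \<kappa> a b = vector [vector [1 - \<kappa> * k1, 0, 0], vector [0, 1 - \<kappa> * k2, 0],
                       vector [- 2 * b, 2 * a, 1 - \<kappa> * k3]]"

definition shift :: "real \<Rightarrow> real \<Rightarrow> real^3" where
  "shift a b = vector [a, b, 0]"

lemma lin_nth [simp]:
  "(lin \<kappa> a b *v z) $ 1 = (1 - \<kappa> * k1) * z$1"
  "(lin \<kappa> a b *v z) $ 2 = (1 - \<kappa> * k2) * z$2"
  "(lin \<kappa> a b *v z) $ 3 = 2 * a * z$2 - 2 * b * z$1 + (1 - \<kappa> * k3) * z$3"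
  by (simp_all add: lin_def matrix_vector_mult_def sum_3 vector_3)

lemma shift_nth [simp]: "shift a b $ 1 = a" "shift a b $ 2 = b" "shift a b $ 3 = 0"
  by (simp_all add: shift_def vector_3)

definition transition :: "real \<Rightarrow> (real^3 \<Rightarrow> real) \<Rightarrow> real^3 \<Rightarrow> real" where
  "transition h f x = mean h (\<lambda>\<kappa> a b. f (lin \<kappa> a b *v x + shift a b))"

text \<open>The contraction behind the theorem. The random terms are symmetric and contribute only their
  square \<open>8 h (z\<^sub>1\<^sup>2 + z\<^sub>2\<^sup>2)\<close>, which reduces the rates \<open>k1\<close> and \<open>k2\<close> of the drift by \<open>4\<close>.\<close>

lemma mean_norm_square_lin:
  assumes "h > 0" "l \<le> k1 - 4" "l \<le> k2 - 4" "l \<le> k3"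
  shows "mean h (\<lambda>\<kappa> a b. (norm (lin \<kappa> a b *v z))\<^sup>2)
           \<le> (1 - 2 * h * l + 2 * h\<^sup>2 * (k1\<^sup>2 + k2\<^sup>2 + k3\<^sup>2)) * (norm z)\<^sup>2"
proof -
  define s where "s = sqrt (8 * h)"
  have s: "s\<^sup>2 = 8 * h" using assms by (simp add: s_def)
  have "mean h (\<lambda>\<kappa> a b. (norm (lin \<kappa> a b *v z))\<^sup>2)
     = (norm z)\<^sup>2 - 2 * h * (k1 * (z$1)\<^sup>2 + k2 * (z$2)\<^sup>2 + k3 * (z$3)\<^sup>2)
       + s\<^sup>2 * ((z$1)\<^sup>2 + (z$2)\<^sup>2)
       + 2 * h\<^sup>2 * (k1\<^sup>2 * (z$1)\<^sup>2 + k2\<^sup>2 * (z$2)\<^sup>2 + k3\<^sup>2 * (z$3)\<^sup>2)"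
    unfolding mean_def norm_square_3 lin_nth s_def[symmetric]
    by (simp add: field_simps power2_eq_square)
  also have "\<dots> = (norm z)\<^sup>2 - 2 * h * ((k1 - 4) * (z$1)\<^sup>2 + (k2 - 4) * (z$2)\<^sup>2 + k3 * (z$3)\<^sup>2)
       + 2 * h\<^sup>2 * (k1\<^sup>2 * (z$1)\<^sup>2 + k2\<^sup>2 * (z$2)\<^sup>2 + k3\<^sup>2 * (z$3)\<^sup>2)"
    unfolding s by (simp add: algebra_simps)
  also have "\<dots> \<le> (norm z)\<^sup>2 - 2 * h * (l * (z$1)\<^sup>2 + l * (z$2)\<^sup>2 + l * (z$3)\<^sup>2)
       + 2 * h\<^sup>2 * ((k1\<^sup>2 + k2\<^sup>2 + k3\<^sup>2) * (z$1)\<^sup>2 + (k1\<^sup>2 + k2\<^sup>2 + k3\<^sup>2) * (z$2)\<^sup>2 + (k1\<^sup>2 + k2\<^sup>2 + k3\<^sup>2) * (z$3)\<^sup>2)"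
    using assms by (intro add_mono diff_mono mult_left_mono mult_right_mono) auto
  also have "\<dots> = (1 - 2 * h * l + 2 * h\<^sup>2 * (k1\<^sup>2 + k2\<^sup>2 + k3\<^sup>2)) * (norm z)\<^sup>2"
    unfolding norm_square_3 by algebra
  finally show ?thesis .
qed

text \<open>The bound for the squared norm passes to the norm by \<open>2 y n \<le> y\<^sup>2 + n\<^sup>2\<close>, with \<open>n\<close> the
  norm before the step.\<close>

lemma mean_norm_lin:
  assumes "h > 0" "l \<le> k1 - 4" "l \<le> k2 - 4" "l \<le> k3"
  shows "mean h (\<lambda>\<kappa> a b. norm (lin \<kappa> a b *v z))
           \<le> (1 - h * l + h\<^sup>2 * (k1\<^sup>2 + k2\<^sup>2 + k3\<^sup>2)) * norm z"
proof (cases "z = 0")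
  case True
  then show ?thesis by (simp add: mean_const)
next
  case False
  define n where "n = norm z"
  have n: "n > 0" using False by (simp add: n_def)
  have "y \<le> 1 / (2 * n) * y\<^sup>2 + n / 2" for y
  proof -
    have "0 \<le> (y - n)\<^sup>2 / (2 * n)" using n by simp
    also have "\<dots> = 1 / (2 * n) * y\<^sup>2 + n / 2 - y"
      using n by (simp add: field_simps power2_eq_square)
    finally show ?thesis by simp
  qed
  then have "mean h (\<lambda>\<kappa> a b. norm (lin \<kappa> a b *v z))
      \<le> mean h (\<lambda>\<kappa> a b. 1 / (2 * n) * (norm (lin \<kappa> a b *v z))\<^sup>2 + n / 2)"
    by (intro mean_mono)
  also have "\<dots> = 1 / (2 * n) * mean h (\<lambda>\<kappa> a b. (norm (lin \<kappa> a b *v z))\<^sup>2) + n / 2"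
    unfolding mean_add mean_mult_left mean_const ..
  also have "\<dots> \<le> 1 / (2 * n) * ((1 - 2 * h * l + 2 * h\<^sup>2 * (k1\<^sup>2 + k2\<^sup>2 + k3\<^sup>2)) * n\<^sup>2) + n / 2"
    using mean_norm_square_lin[OF assms] n unfolding n_def
    by (intro add_mono mult_left_mono) auto
  also have "\<dots> = (1 - h * l + h\<^sup>2 * (k1\<^sup>2 + k2\<^sup>2 + k3\<^sup>2)) * n"
    using n by (simp add: field_simps power2_eq_square)
  finally show ?thesis unfolding n_def .
qed

text \<open>A fourth-order form controlling the fourth power of the norm and decreasing in mean. The noise
  feeds the first two components into the third; the damping \<open>k1, k2 > 4\<close> of the first two pays
  for this if they carry a large enough weight, and \<open>144 / k3 + 64\<close> is what the completed square below requires.\<close>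

definition quartic :: "real^3 \<Rightarrow> real" where
  "quartic z = (z$3)^4 + (144 / k3 + 64) * ((z$1)\<^sup>2 + (z$2)\<^sup>2)\<^sup>2"

lemma quartic_nonneg: "quartic z \<ge> 0"
  using k3 by (simp add: quartic_def)

lemma mean_quartic_lin:
  assumes h: "0 < h" "h \<le> 1" "2 * h * k1 \<le> 1" "2 * h * k2 \<le> 1" "2 * h * k3 \<le> 1"
  shows "mean h (\<lambda>\<kappa> a b. quartic (lin \<kappa> a b *v z)) \<le> quartic z"
proof -
  define c where "c = 144 / k3 + 64"
  have c: "c \<ge> 0" "4 * c * k3 = 576 + 256 * k3" using k3 by (auto simp: c_def field_simps)
  define x y w where xyw: "x = z$1" "y = z$2" "w = z$3"
  define r where "r = x\<^sup>2 + y\<^sup>2"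
  define s where "s = sqrt (8 * h)"
  have s: "s\<^sup>2 = 8 * h" using h by (simp add: s_def)
  have s4: "s^4 = 64 * h\<^sup>2"
    using arg_cong[OF s, of power2] by (simp add: power_mult_distrib flip: power_mult)
  have r: "((1 - 2 * h * k1) * x)\<^sup>2 + ((1 - 2 * h * k2) * y)\<^sup>2 \<le> (1 - 8 * h) * r"
  proof -
    have "(1 - 2 * h * k)\<^sup>2 \<le> 1 - 8 * h" if "4 < k" "2 * h * k \<le> 1" for k
    proof -
      have "(1 - 2 * h * k)\<^sup>2 \<le> (1 - 2 * h * k) * 1"
        unfolding power2_eq_square using that h by (intro mult_left_mono) auto
      also have "\<dots> \<le> 1 - 8 * h" using that h by auto
      finally show ?thesis .
    qed
    then have "(1 - 2 * h * k1)\<^sup>2 * x\<^sup>2 + (1 - 2 * h * k2)\<^sup>2 * y\<^sup>2 \<le> (1 - 8 * h) * x\<^sup>2 + (1 - 8 * h) * y\<^sup>2"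
      using k1 k2 h by (intro add_mono mult_right_mono) auto
    then show ?thesis unfolding r_def power_mult_distrib distrib_left .
  qed
  have "2 * h * 4 \<le> 2 * h * k1" using h k1 by (intro mult_left_mono) auto
  then have h8: "8 * h \<le> 1" using h by linarith
  have "(((1 - 2 * h * k1) * x)\<^sup>2 + ((1 - 2 * h * k2) * y)\<^sup>2)\<^sup>2 \<le> ((1 - 8 * h) * r)\<^sup>2"
    by (intro power_mono r) auto
  also have "\<dots> = (1 - 8 * h) * ((1 - 8 * h) * r\<^sup>2)" by (simp add: power2_eq_square)
  also have "\<dots> \<le> 1 * ((1 - 8 * h) * r\<^sup>2)"
    using h h8 by (intro mult_right_mono) auto
  finally have r2: "(((1 - 2 * h * k1) * x)\<^sup>2 + ((1 - 2 * h * k2) * y)\<^sup>2)\<^sup>2 \<le> (1 - 8 * h) * r\<^sup>2" by simp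
  have w4: "((1 - 2 * h * k3) * w)^4 \<le> (1 - 2 * h * k3) * w^4"
  proof -
    have "(1 - 2 * h * k3)^4 \<le> (1 - 2 * h * k3)^1"
      using h k3 by (intro power_decreasing) auto
    then show ?thesis
      unfolding power_mult_distrib by (intro mult_right_mono) auto
  qed
  have "mean h (\<lambda>\<kappa> a b. quartic (lin \<kappa> a b *v z))
      = (((1 - 2 * h * k3) * w)^4 + c * (((1 - 2 * h * k1) * x)\<^sup>2 + ((1 - 2 * h * k2) * y)\<^sup>2)\<^sup>2) / 2
        + (w^4 + c * r\<^sup>2) / 2 + 6 * s\<^sup>2 * r * w\<^sup>2 + 4 * s^4 * (x^4 + y^4)"
    unfolding mean_def quartic_def lin_nth s_def[symmetric] c_def[symmetric] xyw[symmetric] r_def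
    by (simp add: field_simps eval_nat_numeral)
  also have "\<dots> \<le> ((1 - 2 * h * k3) * w^4 + c * ((1 - 8 * h) * r\<^sup>2)) / 2
        + (w^4 + c * r\<^sup>2) / 2 + 48 * h * r * w\<^sup>2 + 256 * h\<^sup>2 * (x^4 + y^4)"
    using w4 mult_left_mono[OF r2 c(1)] unfolding s s4 by (simp add: field_simps)
  also have "\<dots> \<le> w^4 + c * r\<^sup>2"
  proof -
    have "h\<^sup>2 * (x^4 + y^4) \<le> h * r\<^sup>2"
    proof -
      have "h\<^sup>2 \<le> h * 1" unfolding power2_eq_square using h by (intro mult_left_mono) auto
      moreover have "x^4 + y^4 \<le> r\<^sup>2"
        by (simp add: r_def power2_sum flip: power_mult)
      ultimately show ?thesis using h by (intro mult_mono) auto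
    qed
    moreover have "48 * r * w\<^sup>2 \<le> k3 * w^4 + (576 / k3) * r\<^sup>2"
    proof -
      have "0 \<le> (k3 * w\<^sup>2 - 24 * r)\<^sup>2 / k3" using k3 by simp
      also have "\<dots> = k3 * w^4 + (576 / k3) * r\<^sup>2 - 48 * r * w\<^sup>2"
        using k3 by (simp add: field_simps eval_nat_numeral)
      finally show ?thesis by simp
    qed
    then have "h * (48 * r * w\<^sup>2) \<le> h * (k3 * w^4 + (576 / k3) * r\<^sup>2)"
      using h by (intro mult_left_mono) auto
    moreover have "4 * c * (h * r\<^sup>2) = 576 / k3 * (h * r\<^sup>2) + 256 * (h * r\<^sup>2)"
      by (simp add: c_def algebra_simps)
    ultimately show ?thesis
      by (simp add: algebra_simps add_divide_distrib diff_divide_distrib)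
  qed
  finally show ?thesis
    by (simp add: quartic_def xyw c_def r_def)
qed

section \<open>Value iteration\<close>

context
  fixes h \<delta> :: real and F :: "real^3 \<Rightarrow> real" and DF :: "real^3 \<Rightarrow> real^3" and HF :: "real^3 \<Rightarrow> real^3^3"
begin

text \<open>The \<open>n\<close>-th iterate is the discounted sum of \<open>F\<close> along \<open>n\<close> random steps; in the limit it
  solves \<open>(1 + \<delta> h) v = h F + transition h v\<close>, a discretisation of the equation. The chain rule for affine
  maps turns the recursion into recursions for the gradient and the Hessian.\<close>

primrec iterate :: "nat \<Rightarrow> real^3 \<Rightarrow> real" where
  "iterate 0 = (\<lambda>x. 0)"
| "iterate (Suc n) = (\<lambda>x. (1 / (1 + \<delta> * h)) * (h * F x + transition h (iterate n) x))"

primrec iterate_gradient :: "nat \<Rightarrow> real^3 \<Rightarrow> real^3" where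
  "iterate_gradient 0 = (\<lambda>x. 0)"
| "iterate_gradient (Suc n) = (\<lambda>x. (1 / (1 + \<delta> * h)) *\<^sub>R (h *\<^sub>R DF x +
     mean h (\<lambda>\<kappa> a b. transpose (lin \<kappa> a b) *v iterate_gradient n (lin \<kappa> a b *v x + shift a b))))"

primrec iterate_hessian :: "nat \<Rightarrow> real^3 \<Rightarrow> real^3^3" where
  "iterate_hessian 0 = (\<lambda>x. 0)"
| "iterate_hessian (Suc n) = (\<lambda>x. (1 / (1 + \<delta> * h)) *\<^sub>R (h *\<^sub>R HF x +
     mean h (\<lambda>\<kappa> a b. transpose (lin \<kappa> a b) ** iterate_hessian n (lin \<kappa> a b *v x + shift a b) ** lin \<kappa> a b)))"

end

lemma C2_on_Rn_mean:
  assumes "\<And>\<kappa> a b. C2_on_Rn (f \<kappa> a b) (D \<kappa> a b) (H \<kappa> a b)"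
  shows "C2_on_Rn (\<lambda>x. mean h (\<lambda>\<kappa> a b. f \<kappa> a b x)) (\<lambda>x. mean h (\<lambda>\<kappa> a b. D \<kappa> a b x))
           (\<lambda>x. mean h (\<lambda>\<kappa> a b. H \<kappa> a b x))"
  unfolding mean_def real_scaleR_def
  by (intro C2_on_Rn_add C2_on_Rn_scaleR assms)

lemma C2_on_Rn_iterate:
  assumes "C2_on_Rn F DF HF"
  shows "C2_on_Rn (iterate h \<delta> F n) (iterate_gradient h \<delta> DF n) (iterate_hessian h \<delta> HF n)"
proof (induction n)
  case 0
  show ?case by (simp add: C2_on_Rn_const)
next
  case (Suc n)
  show ?case
    unfolding iterate.simps iterate_gradient.simps iterate_hessian.simps transition_def
    by (intro C2_on_Rn_scaleR C2_on_Rn_add C2_on_Rn_mean C2_on_Rn_affine assms Suc)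
qed

text \<open>Let \<open>J n x z\<close> be an increment or a Taylor remainder of the \<open>n\<close>-th iterate at \<open>x\<close> with displacement
  \<open>z\<close>. As a step acts on \<open>x\<close> by an affine map and on \<open>z\<close> by its linear part, \<open>J\<close> obeys the same
  recursion as the iterates. A bound of the source term by \<open>N\<close> therefore persists, with a
  constant independent of \<open>n\<close>, once the mean of \<open>N\<close> over a step is controlled by \<open>N\<close>.\<close>

lemma iteration_bound:
  fixes J :: "nat \<Rightarrow> real^3 \<Rightarrow> real^3 \<Rightarrow> real"
  assumes h: "h > 0" "\<delta> > 0"
    and J0: "\<And>x z. J 0 x z = 0"
    and JSuc: "\<And>n x z. J (Suc n) x z = (1 / (1 + \<delta> * h)) *
      (h * JF x z + mean h (\<lambda>\<kappa> a b. J n (lin \<kappa> a b *v x + shift a b) (lin \<kappa> a b *v z)))"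
    and JF: "\<And>x z. \<bar>JF x z\<bar> \<le> c * N z"
    and N: "\<And>z. N z \<ge> 0" "\<And>z. mean h (\<lambda>\<kappa> a b. N (lin \<kappa> a b *v z)) \<le> \<rho> * N z"
    and C: "C \<ge> 0" "h * c + \<rho> * C \<le> (1 + \<delta> * h) * C"
  shows "\<bar>J n x z\<bar> \<le> C * N z"
proof (induction n arbitrary: x z)
  case 0
  then show ?case using J0 N C by simp
next
  case (Suc n)
  have "\<bar>mean h (\<lambda>\<kappa> a b. J n (lin \<kappa> a b *v x + shift a b) (lin \<kappa> a b *v z))\<bar>
      \<le> mean h (\<lambda>\<kappa> a b. C * N (lin \<kappa> a b *v z))"
    by (intro abs_mean_le Suc)
  also have "\<dots> \<le> C * (\<rho> * N z)"
    unfolding mean_mult_left by (intro mult_left_mono N C)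
  finally have 1: "\<bar>mean h (\<lambda>\<kappa> a b. J n (lin \<kappa> a b *v x + shift a b) (lin \<kappa> a b *v z))\<bar> \<le> C * (\<rho> * N z)" .
  have 2: "\<bar>h * JF x z\<bar> \<le> h * (c * N z)"
    using JF[of x z] h by (simp add: abs_mult)
  have "\<bar>h * JF x z + mean h (\<lambda>\<kappa> a b. J n (lin \<kappa> a b *v x + shift a b) (lin \<kappa> a b *v z))\<bar>
      \<le> (h * c + \<rho> * C) * N z"
    using 1 2 by (simp add: algebra_simps)
  also have "\<dots> \<le> ((1 + \<delta> * h) * C) * N z"
    by (intro mult_right_mono C N)
  finally have "\<bar>h * JF x z + mean h (\<lambda>\<kappa> a b. J n (lin \<kappa> a b *v x + shift a b) (lin \<kappa> a b *v z))\<bar>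
      \<le> (1 + \<delta> * h) * (C * N z)" by (simp add: mult.assoc)
  moreover have "1 + \<delta> * h > 0" using h by (simp add: add_pos_pos)
  ultimately show ?case
    unfolding JSuc by (simp add: abs_mult abs_divide pos_divide_le_eq mult.commute)
qed

text \<open>The norm contracts by \<open>1 - h l\<close> up to a term of order \<open>h\<^sup>2\<close>. That term is absorbed by the discount
  factor \<open>1 + \<delta> h\<close>, so the constant \<open>L / l\<close> is reached exactly.\<close>

lemma iterate_lipschitz:
  assumes h: "0 < h" and \<delta>: "0 < \<delta>" and l: "0 < l" "l \<le> k1 - 4" "l \<le> k2 - 4" "l \<le> k3"
    and small: "h * (k1\<^sup>2 + k2\<^sup>2 + k3\<^sup>2) \<le> \<delta>"
    and F: "\<And>x z. \<bar>F (x + z) - F x\<bar> \<le> L * norm z" and L: "L \<ge> 0"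
  shows "\<bar>iterate h \<delta> F n (x + z) - iterate h \<delta> F n x\<bar> \<le> L / l * norm z"
proof (rule iteration_bound[where J = "\<lambda>n x z. iterate h \<delta> F n (x + z) - iterate h \<delta> F n x"
      and JF = "\<lambda>x z. F (x + z) - F x" and N = norm and c = L])
  fix n x z
  show "iterate h \<delta> F (Suc n) (x + z) - iterate h \<delta> F (Suc n) x = 1 / (1 + \<delta> * h) * (h * (F (x + z) - F x) +
      mean h (\<lambda>\<kappa> a b. iterate h \<delta> F n (lin \<kappa> a b *v x + shift a b + lin \<kappa> a b *v z) - iterate h \<delta> F n (lin \<kappa> a b *v x + shift a b)))"
    unfolding iterate.simps transition_def mean_diff by (simp add: algebra_simps matrix_vector_right_distrib)
next
  fix z :: "real^3"
  show "mean h (\<lambda>\<kappa> a b. norm (lin \<kappa> a b *v z)) \<le> (1 - h * l + h\<^sup>2 * (k1\<^sup>2 + k2\<^sup>2 + k3\<^sup>2)) * norm z"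
    by (rule mean_norm_lin) (use assms in auto)
next
  have "h * (k1\<^sup>2 + k2\<^sup>2 + k3\<^sup>2) * (h * (L / l)) \<le> \<delta> * (h * (L / l))"
    using small h l L by (intro mult_right_mono) auto
  moreover have "l * (L / l) = L" using l by simp
  ultimately show "h * L + (1 - h * l + h\<^sup>2 * (k1\<^sup>2 + k2\<^sup>2 + k3\<^sup>2)) * (L / l) \<le> (1 + \<delta> * h) * (L / l)"
    using l(1) by (simp add: algebra_simps power2_eq_square)
qed (use assms in auto)

lemma mean_norm_square_lin_le:
  assumes "0 < h" "0 \<le> l" "l \<le> k1 - 4" "l \<le> k2 - 4" "l \<le> k3" and small: "h * (k1\<^sup>2 + k2\<^sup>2 + k3\<^sup>2) \<le> l"
  shows "mean h (\<lambda>\<kappa> a b. (norm (lin \<kappa> a b *v z))\<^sup>2) \<le> (norm z)\<^sup>2"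
proof -
  have "h * (h * (k1\<^sup>2 + k2\<^sup>2 + k3\<^sup>2)) \<le> h * l"
    using assms by (intro mult_left_mono) auto
  then have "1 - 2 * h * l + 2 * h\<^sup>2 * (k1\<^sup>2 + k2\<^sup>2 + k3\<^sup>2) \<le> 1"
    by (simp add: power2_eq_square algebra_simps)
  then have "(1 - 2 * h * l + 2 * h\<^sup>2 * (k1\<^sup>2 + k2\<^sup>2 + k3\<^sup>2)) * (norm z)\<^sup>2 \<le> 1 * (norm z)\<^sup>2"
    by (intro mult_right_mono) auto
  with mean_norm_square_lin[of h l z] assms show ?thesis by simp
qed

text \<open>For the remainders the discount alone suffices: a quantity that does not increase in mean
  sums to at most \<open>1 / \<delta>\<close> times its initial bound.\<close>

lemma iterate_first_order:
  assumes h: "0 < h" and \<delta>: "0 < \<delta>" and l: "0 < l" "l \<le> k1 - 4" "l \<le> k2 - 4" "l \<le> k3"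
    and small: "h * (k1\<^sup>2 + k2\<^sup>2 + k3\<^sup>2) \<le> l"
    and F: "\<And>x z. \<bar>F (x + z) - F x - z \<bullet> DF x\<bar> \<le> B * (norm z)\<^sup>2" and B: "B \<ge> 0"
  shows "\<bar>iterate h \<delta> F n (x + z) - iterate h \<delta> F n x - z \<bullet> iterate_gradient h \<delta> DF n x\<bar> \<le> B / \<delta> * (norm z)\<^sup>2"
proof (rule iteration_bound[where J = "\<lambda>n x z. iterate h \<delta> F n (x + z) - iterate h \<delta> F n x - z \<bullet> iterate_gradient h \<delta> DF n x"
      and JF = "\<lambda>x z. F (x + z) - F x - z \<bullet> DF x" and N = "\<lambda>z. (norm z)\<^sup>2" and c = B and \<rho> = 1])
  fix n x z
  have D: "z \<bullet> mean h (\<lambda>\<kappa> a b. transpose (lin \<kappa> a b) *v iterate_gradient h \<delta> DF n (lin \<kappa> a b *v x + shift a b))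
      = mean h (\<lambda>\<kappa> a b. (lin \<kappa> a b *v z) \<bullet> iterate_gradient h \<delta> DF n (lin \<kappa> a b *v x + shift a b))"
    unfolding mean_def inner_scaleR_right inner_add_right inner_transpose by simp
  show "iterate h \<delta> F (Suc n) (x + z) - iterate h \<delta> F (Suc n) x - z \<bullet> iterate_gradient h \<delta> DF (Suc n) x = 1 / (1 + \<delta> * h) *
      (h * (F (x + z) - F x - z \<bullet> DF x) +
      mean h (\<lambda>\<kappa> a b. iterate h \<delta> F n (lin \<kappa> a b *v x + shift a b + lin \<kappa> a b *v z) - iterate h \<delta> F n (lin \<kappa> a b *v x + shift a b)
         - (lin \<kappa> a b *v z) \<bullet> iterate_gradient h \<delta> DF n (lin \<kappa> a b *v x + shift a b)))"
    unfolding iterate.simps iterate_gradient.simps transition_def mean_diff inner_scaleR_right inner_add_right D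
    by (simp add: algebra_simps matrix_vector_right_distrib)
next
  fix z :: "real^3"
  show "mean h (\<lambda>\<kappa> a b. (norm (lin \<kappa> a b *v z))\<^sup>2) \<le> 1 * (norm z)\<^sup>2"
    using mean_norm_square_lin_le[OF h _ l(2-) small] l by simp
qed (use assms in \<open>auto simp: algebra_simps\<close>)

text \<open>The free weights \<open>p\<close> and \<open>q\<close> allow the cubic remainder of \<open>F\<close> to be split, depending on the time step, into a
  quadratic and a quartic part, for both of which the mean decreases.\<close>

lemma iterate_second_order:
  assumes h: "0 < h" "h \<le> 1" "2 * h * k1 \<le> 1" "2 * h * k2 \<le> 1" "2 * h * k3 \<le> 1"
    and \<delta>: "0 < \<delta>" and l: "0 < l" "l \<le> k1 - 4" "l \<le> k2 - 4" "l \<le> k3"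
    and small: "h * (k1\<^sup>2 + k2\<^sup>2 + k3\<^sup>2) \<le> l"
    and F: "\<And>x z. \<bar>F (x + z) + F (x - z) - 2 * F x - z \<bullet> (HF x *v z)\<bar> \<le> p * (norm z)\<^sup>2 + q * quartic z"
    and pq: "p \<ge> 0" "q \<ge> 0"
  shows "\<bar>iterate h \<delta> F n (x + z) + iterate h \<delta> F n (x - z) - 2 * iterate h \<delta> F n x - z \<bullet> (iterate_hessian h \<delta> HF n x *v z)\<bar>
    \<le> 1 / \<delta> * (p * (norm z)\<^sup>2 + q * quartic z)"
proof (rule iteration_bound[where J = "\<lambda>n x z. iterate h \<delta> F n (x + z) + iterate h \<delta> F n (x - z) - 2 * iterate h \<delta> F n x - z \<bullet> (iterate_hessian h \<delta> HF n x *v z)"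
      and JF = "\<lambda>x z. F (x + z) + F (x - z) - 2 * F x - z \<bullet> (HF x *v z)"
      and N = "\<lambda>z. p * (norm z)\<^sup>2 + q * quartic z" and c = 1 and \<rho> = 1])
  fix n x z
  let ?T = "\<lambda>\<kappa> a b. lin \<kappa> a b *v x + shift a b"
  have D: "z \<bullet> (mean h (\<lambda>\<kappa> a b. transpose (lin \<kappa> a b) ** iterate_hessian h \<delta> HF n (?T \<kappa> a b) ** lin \<kappa> a b) *v z)
      = mean h (\<lambda>\<kappa> a b. (lin \<kappa> a b *v z) \<bullet> (iterate_hessian h \<delta> HF n (?T \<kappa> a b) *v (lin \<kappa> a b *v z)))"
    unfolding mean_def mult_scaleR_matrix mult_add_matrix inner_scaleR_right inner_add_right
      quadratic_form_congruence by simp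
  show "iterate h \<delta> F (Suc n) (x + z) + iterate h \<delta> F (Suc n) (x - z) - 2 * iterate h \<delta> F (Suc n) x - z \<bullet> (iterate_hessian h \<delta> HF (Suc n) x *v z)
     = 1 / (1 + \<delta> * h) *
      (h * (F (x + z) + F (x - z) - 2 * F x - z \<bullet> (HF x *v z)) +
      mean h (\<lambda>\<kappa> a b. iterate h \<delta> F n (?T \<kappa> a b + lin \<kappa> a b *v z) + iterate h \<delta> F n (?T \<kappa> a b - lin \<kappa> a b *v z)
         - 2 * iterate h \<delta> F n (?T \<kappa> a b) - (lin \<kappa> a b *v z) \<bullet> (iterate_hessian h \<delta> HF n (?T \<kappa> a b) *v (lin \<kappa> a b *v z))))"
    unfolding iterate.simps iterate_hessian.simps transition_def mean_diff mean_add mean_mult_left mult_scaleR_matrix mult_add_matrix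
      inner_scaleR_right inner_add_right D
    by (simp add: algebra_simps matrix_vector_right_distrib matrix_vector_mult_diff_distrib)
next
  fix z :: "real^3"
  show "mean h (\<lambda>\<kappa> a b. p * (norm (lin \<kappa> a b *v z))\<^sup>2 + q * quartic (lin \<kappa> a b *v z)) \<le> 1 * (p * (norm z)\<^sup>2 + q * quartic z)"
    unfolding mean_add mean_mult_left mult_1
    by (intro add_mono mult_left_mono mean_norm_square_lin_le[OF h(1) _ l(2-) small] mean_quartic_lin h pq)
      (use l in simp)
next
  show "0 \<le> p * (norm z)\<^sup>2 + q * quartic z" for z
    using pq quartic_nonneg by simp
qed (use assms in \<open>auto simp: algebra_simps\<close>)

lemma mean_norm_square_step:
  assumes "h > 0"
  shows "mean h (\<lambda>\<kappa> a b. (norm (lin \<kappa> a b *v x + shift a b))\<^sup>2)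
    = mean h (\<lambda>\<kappa> a b. (norm (lin \<kappa> a b *v x))\<^sup>2) + 4 * h"
proof -
  define s where "s = sqrt (8 * h)"
  have s: "s\<^sup>2 = 8 * h" using assms by (simp add: s_def)
  have "mean h (\<lambda>\<kappa> a b. (norm (lin \<kappa> a b *v x + shift a b))\<^sup>2)
    = mean h (\<lambda>\<kappa> a b. (norm (lin \<kappa> a b *v x))\<^sup>2) + s\<^sup>2 / 2"
    unfolding mean_def norm_square_3 lin_nth shift_nth vector_add_component s_def[symmetric]
    by (simp add: field_simps power2_eq_square)
  with s show ?thesis by simp
qed

text \<open>Successive iterates differ by \<open>h F\<close> transported by \<open>n\<close> steps and discounted. The weight \<open>8 / \<delta> + |x|\<^sup>2\<close>
  dominates the growth of \<open>F\<close> and increases in mean by at most the factor \<open>1 + h \<delta> / 2\<close>, hence more slowly than the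
  discount, so the differences decay geometrically, locally uniformly.\<close>

lemma iterate_increment:
  assumes h: "0 < h" and \<delta>: "0 < \<delta>" and l: "0 < l" "l \<le> k1 - 4" "l \<le> k2 - 4" "l \<le> k3"
    and small: "h * (k1\<^sup>2 + k2\<^sup>2 + k3\<^sup>2) \<le> l"
    and F: "\<And>x. \<bar>F x\<bar> \<le> A * (8 / \<delta> + (norm x)\<^sup>2)" and A: "A \<ge> 0"
  shows "\<bar>iterate h \<delta> F (Suc n) x - iterate h \<delta> F n x\<bar>
    \<le> h * A * ((1 + h * \<delta> / 2) / (1 + \<delta> * h)) ^ n * (8 / \<delta> + (norm x)\<^sup>2)"
proof (induction n arbitrary: x)
  case 0
  have "\<bar>1 / (1 + \<delta> * h) * (h * F x)\<bar> \<le> 1 * \<bar>h * F x\<bar>"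
    unfolding abs_mult[of "1 / (1 + \<delta> * h)"] using mult_pos_pos[OF \<delta> h]
    by (intro mult_right_mono) (auto simp: divide_le_eq_1)
  also have "\<dots> \<le> h * (A * (8 / \<delta> + (norm x)\<^sup>2))"
    using F[of x] h by (simp add: abs_mult)
  finally show ?case by (simp add: transition_def mean_const mult.assoc)
next
  case (Suc n)
  let ?w = "(1 + h * \<delta> / 2) / (1 + \<delta> * h)"
  have w: "?w \<ge> 0" using h \<delta> by simp
  have iterate_Suc: "iterate h \<delta> F (Suc m) x = 1 / (1 + \<delta> * h) * (h * F x + transition h (iterate h \<delta> F m) x)" for m
    by simp
  let ?T = "\<lambda>\<kappa> a b. lin \<kappa> a b *v x + shift a b"
  let ?d = "\<lambda>y. iterate h \<delta> F (Suc n) y - iterate h \<delta> F n y" and ?V = "\<lambda>y. 8 / \<delta> + (norm y)\<^sup>2"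
  have eq: "iterate h \<delta> F (Suc (Suc n)) x - iterate h \<delta> F (Suc n) x
      = 1 / (1 + \<delta> * h) * mean h (\<lambda>\<kappa> a b. ?d (?T \<kappa> a b))"
    unfolding iterate_Suc[of "Suc n"] iterate_Suc[of n] mean_diff transition_def[symmetric]
    by (simp add: algebra_simps del: iterate.simps)
  have "\<bar>mean h (\<lambda>\<kappa> a b. ?d (?T \<kappa> a b))\<bar> \<le> mean h (\<lambda>\<kappa> a b. h * A * ?w ^ n * ?V (?T \<kappa> a b))"
    by (intro abs_mean_le Suc)
  also have "\<dots> = h * A * ?w ^ n * (8 / \<delta> + (mean h (\<lambda>\<kappa> a b. (norm (lin \<kappa> a b *v x))\<^sup>2) + 4 * h))"
    by (simp only: mean_mult_left mean_add mean_const mean_norm_square_step[OF h])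
  also have "\<dots> \<le> h * A * ?w ^ n * ((1 + h * \<delta> / 2) * ?V x)"
  proof (intro mult_left_mono)
    have "mean h (\<lambda>\<kappa> a b. (norm (lin \<kappa> a b *v x))\<^sup>2) \<le> (norm x)\<^sup>2"
      using mean_norm_square_lin_le[OF h _ l(2-) small] l by simp
    moreover have "h * \<delta> / 2 * (8 / \<delta>) = 4 * h" using \<delta> by simp
    moreover have "h * \<delta> / 2 * (norm x)\<^sup>2 \<ge> 0" using h \<delta> by simp
    ultimately show "8 / \<delta> + (mean h (\<lambda>\<kappa> a b. (norm (lin \<kappa> a b *v x))\<^sup>2) + 4 * h)
      \<le> (1 + h * \<delta> / 2) * ?V x"
      unfolding distrib_right distrib_left by linarith
  qed (use h A w in simp)
  finally have "1 / (1 + \<delta> * h) * \<bar>mean h (\<lambda>\<kappa> a b. ?d (?T \<kappa> a b))\<bar>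
      \<le> 1 / (1 + \<delta> * h) * (h * A * ?w ^ n * ((1 + h * \<delta> / 2) * ?V x))"
    using h \<delta> by (intro mult_left_mono) auto
  moreover have "1 / (1 + \<delta> * h) * (h * A * ?w ^ n * ((1 + h * \<delta> / 2) * ?V x)) = h * A * ?w ^ Suc n * ?V x"
    by simp
  moreover have "1 / (1 + \<delta> * h) > 0" using h \<delta> by (simp add: add_pos_pos)
  ultimately show ?case
    unfolding eq abs_mult[of "1 / (1 + \<delta> * h)"] by (simp only: abs_of_pos)
qed

text \<open>The second-order operator of the equation, so that the equation reads \<open>\<delta> u - generator u = F\<close>;
  \<open>sigma1\<close> and \<open>sigma2\<close> are the columns of \<open>\<sigma>\<close>.\<close>

definition generator :: "real^3 \<Rightarrow> real^3 \<Rightarrow> real^3^3 \<Rightarrow> real" where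
  "generator x p X = trace (sigma x ** transpose (sigma x) ** X) + drift k1 k2 k3 x \<bullet> p"

definition sigma1 :: "real^3 \<Rightarrow> real^3" where "sigma1 x = vector [1, 0, 2 * x$2]"
definition sigma2 :: "real^3 \<Rightarrow> real^3" where "sigma2 x = vector [0, 1, - 2 * x$1]"

lemma trace_sigma:
  "trace (sigma x ** transpose (sigma x) ** X)
     = sigma1 x \<bullet> (X *v sigma1 x) + sigma2 x \<bullet> (X *v sigma2 x)"
  by (simp add: trace_def sigma_def sigma1_def sigma2_def matrix_matrix_mult_def transpose_def
      matrix_vector_mult_def inner_vec_def sum_3 sum_2 vector_3 vector_2 algebra_simps)

lemma step_noise:
  "lin 0 a b *v x + shift a b = x + a *\<^sub>R sigma1 x + b *\<^sub>R sigma2 x"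
  by (simp add: vec_eq_iff forall_3 sigma1_def sigma2_def vector_3)

lemma step_drift:
  "lin \<kappa> 0 0 *v x + shift 0 0 = x + \<kappa> *\<^sub>R drift k1 k2 k3 x"
  by (simp add: vec_eq_iff forall_3 drift_def vector_3 algebra_simps)

lemma quartic_scaleR: "quartic (s *\<^sub>R z) = s^4 * quartic z"
  by (simp add: quartic_def algebra_simps eval_nat_numeral)

text \<open>The drift move produces the first-order part of the generator, and the two opposite moves along a
  column produce the Hessian form on that column. The Taylor bounds turn into an error
  \<open>h * sqrt h\<close> because the weights \<open>p * sqrt h\<close> and \<open>p / sqrt h\<close> balance displacements of
  size \<open>sqrt h\<close>.\<close>

lemma consistency:
  assumes h: "0 < h" "h \<le> 1" and c: "B \<ge> 0" "p \<ge> 0"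
    and D: "\<And>z. \<bar>f (x + z) - f x - z \<bullet> D\<bar> \<le> B * (norm z)\<^sup>2"
    and H: "\<And>z. \<bar>f (x + z) + f (x - z) - 2 * f x - z \<bullet> (X *v z)\<bar>
              \<le> p * sqrt h * (norm z)\<^sup>2 + p / sqrt h * quartic z"
  shows "\<bar>transition h f x - f x - h * generator x D X\<bar>
    \<le> h * sqrt h * (2 * B * (norm (drift k1 k2 k3 x))\<^sup>2 +
        p * ((norm (sigma1 x))\<^sup>2 + 8 * quartic (sigma1 x) + (norm (sigma2 x))\<^sup>2 + 8 * quartic (sigma2 x)))"
proof -
  define s where "s = sqrt (8 * h)"
  have s: "s\<^sup>2 = 8 * h" using h by (simp add: s_def)
  have s4: "s^4 = 64 * h\<^sup>2"
    using arg_cong[OF s, of power2] by (simp add: power_mult_distrib flip: power_mult)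
  define r where "r = sqrt h"
  have r: "r > 0" "h = r * r" using h by (auto simp: r_def)
  let ?b = "drift k1 k2 k3 x"
  define E0 where "E0 = f (x + (2 * h) *\<^sub>R ?b) - f x - (2 * h) *\<^sub>R ?b \<bullet> D"
  define E where "E = (\<lambda>z. f (x + s *\<^sub>R z) + f (x - s *\<^sub>R z) - 2 * f x - s *\<^sub>R z \<bullet> (X *v (s *\<^sub>R z)))"
  have "s *\<^sub>R z \<bullet> (X *v (s *\<^sub>R z)) = 8 * h * (z \<bullet> (X *v z))" for z
    using s by (simp add: power2_eq_square matrix_vector_mult_scaleR)
  then have eq: "transition h f x - f x - h * generator x D X = E0 / 2 + (E (sigma1 x) + E (sigma2 x)) / 8"
    unfolding transition_def mean_def step_drift step_noise generator_def trace_sigma E0_def E_def s_def[symmetric]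
    by (simp add: field_simps)
  have E0_le: "\<bar>E0\<bar> \<le> h * r * (4 * B * (norm ?b)\<^sup>2)"
  proof -
    have "\<bar>E0\<bar> \<le> B * (norm ((2 * h) *\<^sub>R ?b))\<^sup>2"
      unfolding E0_def by (rule D)
    also have "\<dots> = h * h * (4 * B * (norm ?b)\<^sup>2)"
      by (simp add: power_mult_distrib power2_eq_square)
    also have "\<dots> \<le> h * r * (4 * B * (norm ?b)\<^sup>2)"
    proof (intro mult_right_mono mult_left_mono)
      have "r \<le> 1" using h by (simp add: r_def)
      then show "h \<le> r" using r by (simp add: mult_left_le)
    qed (use c h in auto)
    finally show ?thesis .
  qed
  have E_le: "\<bar>E z\<bar> \<le> h * r * (8 * p * ((norm z)\<^sup>2 + 8 * quartic z))" for z
  proof -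
    have "\<bar>E z\<bar> \<le> p * r * (norm (s *\<^sub>R z))\<^sup>2 + p / r * quartic (s *\<^sub>R z)"
      unfolding E_def r_def by (rule H)
    also have "\<dots> = p * r * (8 * h) * (norm z)\<^sup>2 + p / r * (64 * h\<^sup>2) * quartic z"
      by (simp add: power_mult_distrib quartic_scaleR s s4)
    also have "\<dots> = h * r * (8 * p * ((norm z)\<^sup>2 + 8 * quartic z))"
      using r by (simp add: power2_eq_square field_simps)
    finally show ?thesis .
  qed
  have combine: "\<bar>e0 / 2 + (e1 + e2) / 8\<bar> \<le> a / 2 + (b + c) / 8"
    if "\<bar>e0\<bar> \<le> a" "\<bar>e1\<bar> \<le> b" "\<bar>e2\<bar> \<le> c" for e0 e1 e2 a b c :: real
    using that by (auto simp: abs_le_iff field_simps)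
  have "\<bar>E0 / 2 + (E (sigma1 x) + E (sigma2 x)) / 8\<bar>
    \<le> h * r * (4 * B * (norm ?b)\<^sup>2) / 2 + (h * r * (8 * p * ((norm (sigma1 x))\<^sup>2 + 8 * quartic (sigma1 x)))
      + h * r * (8 * p * ((norm (sigma2 x))\<^sup>2 + 8 * quartic (sigma2 x)))) / 8"
    by (intro combine E0_le E_le)
  then show ?thesis
    unfolding eq r_def[symmetric] by (simp add: algebra_simps add_divide_distrib)
qed

lemma norm_power4_le_quartic: "norm z ^ 4 \<le> 2 * quartic z"
proof -
  let ?r = "(z$1)\<^sup>2 + (z$2)\<^sup>2"
  have "norm z ^ 4 = (?r + (z$3)\<^sup>2)\<^sup>2"
    by (metis add.assoc mult_2_right norm_square_3 numeral_Bit0 power2_eq_square power_add)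
  also have "\<dots> \<le> 2 * ?r\<^sup>2 + 2 * (z$3)^4"
    using sum_squares_bound[of ?r "(z$3)\<^sup>2"] by (simp add: power2_sum flip: power_mult)
  also have "\<dots> \<le> 2 * quartic z"
  proof -
    have "1 * ?r\<^sup>2 \<le> (144 / k3 + 64) * ?r\<^sup>2"
      using k3 by (intro mult_right_mono) auto
    then show ?thesis by (simp add: quartic_def)
  qed
  finally show ?thesis .
qed

text \<open>First the time step is chosen, making the consistency error small on the ball of radius \<open>R\<close>,
  and then the number of iterations, making the last increment small. The Lipschitz constant
  \<open>L / l\<close> is not affected by either choice.\<close>

lemma approximate_solution:
  assumes \<delta>: "0 < \<delta>" and e: "0 < e" and l: "0 < l" "l \<le> k1 - 4" "l \<le> k2 - 4" "l \<le> k3"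
    and C2: "C2_on_Rn F DF HF"
    and F0: "\<And>x z. \<bar>F (x + z) - F x\<bar> \<le> L * norm z" and L: "L \<ge> 0"
    and F1: "\<And>x z. \<bar>F (x + z) - F x - z \<bullet> DF x\<bar> \<le> B * (norm z)\<^sup>2" and B: "B \<ge> 0"
    and F2: "\<And>x z. \<bar>F (x + z) + F (x - z) - 2 * F x - z \<bullet> (HF x *v z)\<bar> \<le> c * norm z ^ 3" and c: "c \<ge> 0"
  obtains w Dw Hw where "C2_on_Rn w Dw Hw"
    and "\<And>x z. \<bar>w (x + z) - w x\<bar> \<le> L / l * norm z"
    and "\<And>x. norm x \<le> R \<Longrightarrow> \<bar>\<delta> * w x - generator x (Dw x) (Hw x) - F x\<bar> \<le> e"
proof -
  define G where "G = (\<lambda>x. 2 * (B / \<delta>) * (norm (drift k1 k2 k3 x))\<^sup>2 +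
    (c / \<delta>) * ((norm (sigma1 x))\<^sup>2 + 8 * quartic (sigma1 x) + (norm (sigma2 x))\<^sup>2 + 8 * quartic (sigma2 x)))"
  have "continuous_on (cball 0 R) G"
    unfolding G_def quartic_def norm_square_3 drift_def sigma1_def sigma2_def
    using \<delta> by (simp add: vector_3) (intro continuous_intros ballI, auto)
  then have "bounded (G ` cball 0 R)"
    by (intro compact_imp_bounded compact_continuous_image) auto
  then obtain M where M: "M > 0" "\<And>x. norm x \<le> R \<Longrightarrow> \<bar>G x\<bar> \<le> M"
    unfolding bounded_pos by auto
  \<comment> \<open>any \<open>A\<close> for which \<open>|F|\<close> is at most \<open>A\<close> times the weight of \<open>iterate_increment\<close>\<close>
  define A where "A = max \<bar>F 0\<bar> L * (1 + \<delta>)"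
  have A: "A \<ge> 0" using \<delta> by (simp add: A_def)
  have FA: "\<bar>F x\<bar> \<le> A * (8 / \<delta> + (norm x)\<^sup>2)" for x
  proof -
    have "\<bar>F x\<bar> \<le> \<bar>F 0\<bar> + L * norm x" using F0[of 0 x] by simp
    also have "\<dots> \<le> max \<bar>F 0\<bar> L + max \<bar>F 0\<bar> L * norm x"
      by (intro add_mono mult_right_mono) auto
    also have "\<dots> = max \<bar>F 0\<bar> L * (1 + norm x)" by (simp add: algebra_simps)
    also have "\<dots> \<le> max \<bar>F 0\<bar> L * ((1 + \<delta>) * (8 / \<delta> + (norm x)\<^sup>2))"
    proof (intro mult_left_mono)
      have "norm x \<le> 1 + (norm x)\<^sup>2"
        using zero_le_power2[of "norm x - 1/2"] by (simp add: power2_eq_square algebra_simps)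
      moreover have "(1 + \<delta>) * (8 / \<delta> + (norm x)\<^sup>2) = 8 / \<delta> + 8 + (norm x)\<^sup>2 + \<delta> * (norm x)\<^sup>2"
        using \<delta> by (simp add: field_simps)
      moreover have "8 / \<delta> \<ge> 0" "\<delta> * (norm x)\<^sup>2 \<ge> 0" using \<delta> by auto
      ultimately show "1 + norm x \<le> (1 + \<delta>) * (8 / \<delta> + (norm x)\<^sup>2)" by linarith
    qed auto
    finally show ?thesis by (simp add: A_def mult.assoc)
  qed
  let ?K = "k1\<^sup>2 + k2\<^sup>2 + k3\<^sup>2"
  have small: "\<forall>\<^sub>F h in at_right 0. g h < t" if "(g \<longlongrightarrow> 0) (at_right 0)" "t > 0" for g :: "real \<Rightarrow> real" and t
    using order_tendstoD(2)[OF that] .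
  have "\<forall>\<^sub>F h in at_right 0. 0 < h \<and> h < 1 \<and> 2 * h * k1 < 1 \<and> 2 * h * k2 < 1 \<and> 2 * h * k3 < 1
      \<and> h * ?K < l \<and> h * ?K < \<delta> \<and> sqrt h * M < e / 2"
    by (intro eventually_conj small) (use l \<delta> e in \<open>auto intro!: tendsto_eq_intros simp: eventually_at_right_less\<close>)
  then obtain h where h: "0 < h" "h \<le> 1" "2 * h * k1 \<le> 1" "2 * h * k2 \<le> 1" "2 * h * k3 \<le> 1"
      "h * ?K \<le> l" "h * ?K \<le> \<delta>" "sqrt h * M \<le> e / 2"
    using eventually_happens'[OF trivial_limit_at_right_real, of _ "0::real"] by (smt (verit, ccfv_SIG))
  define \<omega> where "\<omega> = (1 + h * \<delta> / 2) / (1 + \<delta> * h)"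
  have \<omega>: "0 \<le> \<omega>" "\<omega> < 1"
    using mult_pos_pos[OF \<delta> h(1)] by (auto simp: \<omega>_def mult.commute divide_less_eq)
  have "(\<lambda>n. (1 + \<delta> * h) * A * (8 / \<delta> + R\<^sup>2) * \<omega> ^ n) \<longlonglongrightarrow> (1 + \<delta> * h) * A * (8 / \<delta> + R\<^sup>2) * 0"
    using \<omega> by (intro tendsto_mult_left LIMSEQ_power_zero) auto
  then have "\<forall>\<^sub>F n in sequentially. (1 + \<delta> * h) * A * (8 / \<delta> + R\<^sup>2) * \<omega> ^ n < e / 2"
    by (rule order_tendstoD(2)) (use e in simp)
  then obtain n where n: "(1 + \<delta> * h) * A * (8 / \<delta> + R\<^sup>2) * \<omega> ^ n < e / 2"
    by (auto simp: eventually_sequentially)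
  let ?v = "iterate h \<delta> F n" and ?D = "iterate_gradient h \<delta> DF n" and ?H = "iterate_hessian h \<delta> HF n"
  have F2': "\<bar>F (x + z) + F (x - z) - 2 * F x - z \<bullet> (HF x *v z)\<bar>
      \<le> c * sqrt h * (norm z)\<^sup>2 + c / sqrt h * quartic z" for x z
  proof -
    let ?r = "sqrt h" and ?n = "norm z"
    have r: "?r > 0" using h by simp
    \<comment> \<open>\<open>n\<^sup>3\<close> is the geometric mean of \<open>r n\<^sup>2\<close> and \<open>n\<^sup>4 / r\<close>; with \<open>r = sqrt h\<close> both are of the same order at \<open>n = sqrt h\<close>.\<close>
    have "0 \<le> ?n\<^sup>2 * (?n - ?r)\<^sup>2 / (2 * ?r)" using r by simp
    also have "\<dots> = (?r * ?n\<^sup>2 / 2 + ?n^4 / (2 * ?r)) - ?n^3"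
      using r by (simp add: field_simps eval_nat_numeral)
    finally have "?n^3 \<le> ?r * ?n\<^sup>2 / 2 + ?n^4 / (2 * ?r)" by simp
    also have "\<dots> \<le> ?r * ?n\<^sup>2 + (2 * quartic z) / (2 * ?r)"
      using r norm_power4_le_quartic[of z] by (intro add_mono divide_right_mono) auto
    finally have "c * ?n^3 \<le> c * (?r * ?n\<^sup>2 + quartic z / ?r)"
      using c by (intro mult_left_mono) auto
    with F2[of x z] show ?thesis by (simp add: algebra_simps)
  qed
  have res: "\<bar>\<delta> * ?v x - generator x (?D x) (?H x) - F x\<bar> \<le> e" if x: "norm x \<le> R" for x
  proof -
    have "\<bar>transition h ?v x - ?v x - h * generator x (?D x) (?H x)\<bar> \<le> h * sqrt h * G x"
      unfolding G_def
    proof (rule consistency[OF h(1,2)])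
      show "\<bar>?v (x + z) - ?v x - z \<bullet> ?D x\<bar> \<le> B / \<delta> * (norm z)\<^sup>2" for z
        by (rule iterate_first_order[OF h(1) \<delta> l h(6) F1 B])
      show "\<bar>?v (x + z) + ?v (x - z) - 2 * ?v x - z \<bullet> (?H x *v z)\<bar>
          \<le> c / \<delta> * sqrt h * (norm z)\<^sup>2 + c / \<delta> / sqrt h * quartic z" for z
        using iterate_second_order[OF h(1-5) \<delta> l h(6) F2', of n x z] c h by (simp add: algebra_simps)
    qed (use B c \<delta> in auto)
    also have "\<dots> \<le> h * (e / 2)"
    proof -
      have "sqrt h * G x \<le> sqrt h * M" using M(2)[OF x] h by (intro mult_left_mono) auto
      then have "sqrt h * G x \<le> e / 2" using h(8) by (rule order_trans)
      with h show ?thesis unfolding mult.assoc by (intro mult_left_mono) auto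
    qed
    finally have 1: "\<bar>transition h ?v x - ?v x - h * generator x (?D x) (?H x)\<bar> \<le> h * (e / 2)" .
    have dh: "1 + \<delta> * h > 0" using h \<delta> by (simp add: add_pos_pos)
    have "\<bar>iterate h \<delta> F (Suc n) x - ?v x\<bar> \<le> h * A * \<omega> ^ n * (8 / \<delta> + (norm x)\<^sup>2)"
      unfolding \<omega>_def by (rule iterate_increment[OF h(1) \<delta> l h(6) FA A])
    also have "\<dots> \<le> h * A * \<omega> ^ n * (8 / \<delta> + R\<^sup>2)"
      using x h A \<omega> by (intro mult_left_mono add_left_mono power_mono) auto
    finally have "(1 + \<delta> * h) * \<bar>iterate h \<delta> F (Suc n) x - ?v x\<bar> \<le> (1 + \<delta> * h) * (h * A * \<omega> ^ n * (8 / \<delta> + R\<^sup>2))"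
      using dh by (intro mult_left_mono) auto
    also have "\<dots> = h * ((1 + \<delta> * h) * A * (8 / \<delta> + R\<^sup>2) * \<omega> ^ n)" by (simp add: algebra_simps)
    also have "\<dots> \<le> h * (e / 2)" using n h by (intro mult_left_mono) auto
    finally have 2: "\<bar>(1 + \<delta> * h) * (iterate h \<delta> F (Suc n) x - ?v x)\<bar> \<le> h * (e / 2)"
      using dh by (simp add: abs_mult)
    have 3: "(1 + \<delta> * h) * iterate h \<delta> F (Suc n) x = h * F x + transition h ?v x"
      using dh by simp
    have eq: "h * (\<delta> * ?v x - generator x (?D x) (?H x) - F x)
        = (transition h ?v x - ?v x - h * generator x (?D x) (?H x)) - (1 + \<delta> * h) * (iterate h \<delta> F (Suc n) x - ?v x)"
      using 3 by (simp add: algebra_simps del: iterate.simps)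
    have "\<bar>h * (\<delta> * ?v x - generator x (?D x) (?H x) - F x)\<bar> \<le> h * e"
      using order_trans[OF abs_triangle_ineq4 add_mono[OF 1 2]] unfolding eq by (simp add: mult.commute del: iterate.simps)
    then show ?thesis using h by (simp add: abs_mult)
  qed
  show thesis
    using that[OF C2_on_Rn_iterate[OF C2] iterate_lipschitz[OF h(1) \<delta> l h(7) F0 L] res] .
qed

section \<open>Comparison with viscosity solutions\<close>

lemma OU_equation_eq: "OU_equation k1 k2 k3 F \<delta> x r p X = \<delta> * r - generator x p X - F x"
  by (simp add: OU_equation_def generator_def)

lemma generator_linear: "generator x (c *\<^sub>R p + q) (c *\<^sub>R X + Y) = c * generator x p X + generator x q Y"
  unfolding generator_def trace_sigma mult_add_matrix mult_scaleR_matrix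
  by (simp add: inner_add_right algebra_simps)

lemma generator_scaleR: "generator x (c *\<^sub>R p) (c *\<^sub>R X) = c * generator x p X"
  unfolding generator_def trace_sigma mult_scaleR_matrix by (simp add: algebra_simps)

text \<open>The squared norm is a Lyapunov function: the quadratic growth of the diffusion coefficients, \<open>8 (x\<^sub>1\<^sup>2 + x\<^sub>2\<^sup>2)\<close>, is
  compensated by the drift precisely when \<open>k1, k2 \<ge> 4\<close>.\<close>

lemma generator_norm_square_le: "generator x (2 *\<^sub>R x) (2 *\<^sub>R mat 1) \<le> 4"
proof -
  have "generator x (2 *\<^sub>R x) (2 *\<^sub>R mat 1)
      = 4 - 2 * ((k1 - 4) * (x$1)\<^sup>2 + (k2 - 4) * (x$2)\<^sup>2 + k3 * (x$3)\<^sup>2)"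
    unfolding generator_def trace_sigma mult_scaleR_matrix
    by (simp add: inner_vec_def sum_3 sigma1_def sigma2_def drift_def vector_3 power2_eq_square algebra_simps)
  also have "\<dots> \<le> 4"
  proof -
    have "(k1 - 4) * (x$1)\<^sup>2 + (k2 - 4) * (x$2)\<^sup>2 + k3 * (x$3)\<^sup>2 \<ge> 0"
      using k1 k2 k3 by (intro add_nonneg_nonneg mult_nonneg_nonneg) auto
    then have "0 \<le> 2 * ((k1 - 4) * (x$1)\<^sup>2 + (k2 - 4) * (x$2)\<^sup>2 + k3 * (x$3)\<^sup>2)"
      by (rule mult_nonneg_nonneg[rotated]) simp
    then show ?thesis unfolding diff_le_eq le_add_same_cancel1 .
  qed
  finally show ?thesis .
qed

text \<open>The functions \<open>u\<close> and \<open>w\<close> grow linearly, hence \<open>u - w - \<eta> |x|\<^sup>2\<close> has a global maximum. Comparing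
  its value there with the one at the origin bounds the location of the maximum in terms of \<open>\<delta>\<close>, \<open>\<eta>\<close>, the growth of \<open>u\<close> and the
  Lipschitz constant of \<open>w\<close>. Thus \<open>w\<close> has to be an approximate supersolution just on a ball that
  can be fixed before \<open>w\<close> is constructed. At the maximum \<open>w + \<eta> |x|\<^sup>2\<close> is a test function for \<open>u\<close>.\<close>

lemma subsolution_le_approximate_supersolution:
  assumes \<delta>: "0 < \<delta>" and \<eta>: "0 < \<eta>" and \<Lambda>: "0 \<le> \<Lambda>"
    and cont: "continuous_on UNIV u" and sub: "viscosity_subsolution (OU_equation k1 k2 k3 F \<delta>) u"
    and growth: "\<And>y. \<bar>u y\<bar> \<le> C * (norm y + 1 / \<delta>)"
    and C2: "C2_on_Rn w Dw Hw"
    and lip: "\<And>x z. \<bar>w (x + z) - w x\<bar> \<le> \<Lambda> * norm z"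
    and super: "\<And>x. norm x \<le> 1 + (C + \<Lambda> + 2 * C / \<delta>) / \<eta> \<Longrightarrow> \<delta> * w x - generator x (Dw x) (Hw x) - F x \<ge> - e"
  shows "u y - w y \<le> \<eta> * (4 / \<delta> + (norm y)\<^sup>2) + e / \<delta>"
proof -
  define R where "R = 1 + (C + \<Lambda> + 2 * C / \<delta>) / \<eta>"
  have C: "C \<ge> 0"
  proof -
    have "0 \<le> C * (1 / \<delta>)" using growth[of 0] by (simp add: order_trans[OF abs_ge_zero])
    then show ?thesis using \<delta> by (simp add: zero_le_divide_iff)
  qed
  have R: "R \<ge> 1" using C \<Lambda> \<delta> \<eta> by (simp add: R_def)
  define \<phi> where "\<phi> = (\<lambda>x. \<eta> * (x \<bullet> x) + w x)"
  have C2\<phi>: "C2_on_Rn \<phi> (\<lambda>x. \<eta> *\<^sub>R (2 *\<^sub>R x) + Dw x) (\<lambda>x. \<eta> *\<^sub>R (2 *\<^sub>R mat 1) + Hw x)"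
    unfolding \<phi>_def by (intro C2_on_Rn_add C2_on_Rn_scaleR C2_on_Rn_norm_square C2)
  have cont_diff: "continuous_on UNIV (\<lambda>x. u x - \<phi> x)"
    by (intro continuous_on_diff cont C2_on_Rn_continuous_on[OF C2\<phi>])
  have outside: "u x - \<phi> x < u 0 - \<phi> 0" if "norm x > R" for x
  proof -
    have x1: "norm x \<ge> 1" using that R by simp
    have "u x - u 0 + (w 0 - w x) \<le> C * (norm x + 1 / \<delta>) + C * (1 / \<delta>) + \<Lambda> * norm x"
      using growth[of x] growth[of 0] lip[of 0 x] by (simp add: abs_le_iff)
    also have "\<dots> = (C + \<Lambda>) * norm x + (2 * C / \<delta>) * 1"
      by (simp add: algebra_simps)
    also have "\<dots> \<le> (C + \<Lambda>) * norm x + (2 * C / \<delta>) * norm x"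
      using x1 C \<delta> by (intro add_left_mono mult_left_mono) auto
    also have "\<dots> = \<eta> * (R - 1) * norm x"
    proof -
      have "\<eta> * (R - 1) = C + \<Lambda> + 2 * C / \<delta>" using \<eta> by (simp add: R_def)
      then show ?thesis by (simp only: distrib_right)
    qed
    also have "\<dots> < \<eta> * norm x * norm x"
      using that R \<eta> x1 by (intro mult_strict_right_mono mult_strict_left_mono) auto
    finally show ?thesis
      by (simp add: \<phi>_def mult.assoc flip: power2_eq_square power2_norm_eq_inner)
  qed
  have ball: "compact (cball 0 R :: (real^3) set)" "cball 0 R \<noteq> ({} :: (real^3) set)"
    using R by auto
  obtain m where m: "m \<in> cball 0 R" "\<And>x. x \<in> cball 0 R \<Longrightarrow> u x - \<phi> x \<le> u m - \<phi> m"
    using continuous_attains_sup[OF ball continuous_on_subset[OF cont_diff subset_UNIV]] by blast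
  have max: "u x - \<phi> x \<le> u m - \<phi> m" for x
    using outside[of x] m(2)[of x] m(2)[of 0] R by (cases "norm x \<le> R") auto
  have "\<forall>\<^sub>F z in nhds m. u z - \<phi> z \<le> u m - \<phi> m"
    using max by (intro always_eventually allI)
  then have "OU_equation k1 k2 k3 F \<delta> m (u m) (\<eta> *\<^sub>R (2 *\<^sub>R m) + Dw m) (\<eta> *\<^sub>R (2 *\<^sub>R mat 1) + Hw m) \<le> 0"
    using sub[unfolded viscosity_subsolution_def, rule_format, OF C2\<phi>] by blast
  then have "\<delta> * u m - F m \<le> \<eta> * generator m (2 *\<^sub>R m) (2 *\<^sub>R mat 1) + generator m (Dw m) (Hw m)"
    unfolding OU_equation_eq generator_linear by simp
  moreover have "\<delta> * w m - generator m (Dw m) (Hw m) - F m \<ge> - e"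
    using super m(1) by (simp add: R_def)
  moreover have "\<eta> * generator m (2 *\<^sub>R m) (2 *\<^sub>R mat 1) \<le> \<eta> * 4"
    using \<eta> generator_norm_square_le by (intro mult_left_mono) auto
  ultimately have "\<delta> * (u m - w m) \<le> \<eta> * 4 + e"
    by (simp add: right_diff_distrib)
  then have "u m - w m \<le> (\<eta> * 4 + e) / \<delta>"
    using \<delta> by (simp add: pos_le_divide_eq mult.commute)
  moreover have "u m - \<phi> m \<le> u m - w m" using \<eta> by (simp add: \<phi>_def)
  ultimately have "u y - \<phi> y \<le> (\<eta> * 4 + e) / \<delta>" using max[of y] by simp
  then show ?thesis
    by (simp add: \<phi>_def power2_norm_eq_inner algebra_simps add_divide_distrib)
qed

text \<open>By linearity, a lower bound for a supersolution is an upper bound for its negative, which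
  is a subsolution for the right-hand side \<open>- F\<close>.\<close>

lemma viscosity_supersolution_uminus:
  assumes "viscosity_supersolution (OU_equation k1 k2 k3 F \<delta>) u"
  shows "viscosity_subsolution (OU_equation k1 k2 k3 (\<lambda>x. - F x) \<delta>) (\<lambda>x. - u x)"
  unfolding viscosity_subsolution_def
proof (intro allI impI)
  fix \<phi> D H x
  assume C2: "C2_on_Rn \<phi> D H" and max: "\<forall>\<^sub>F z in nhds x. - u z - \<phi> z \<le> - u x - \<phi> x"
  have "C2_on_Rn (\<lambda>x. - 1 * \<phi> x) (\<lambda>x. - 1 *\<^sub>R D x) (\<lambda>x. - 1 *\<^sub>R H x)"
    by (rule C2_on_Rn_scaleR[OF C2])
  moreover have "\<forall>\<^sub>F z in nhds x. u z - (- 1 * \<phi> z) \<ge> u x - (- 1 * \<phi> x)"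
    using max by (rule eventually_mono) simp
  ultimately have "OU_equation k1 k2 k3 F \<delta> x (u x) (- 1 *\<^sub>R D x) (- 1 *\<^sub>R H x) \<ge> 0"
    using assms unfolding viscosity_supersolution_def by blast
  then show "OU_equation k1 k2 k3 (\<lambda>x. - F x) \<delta> x (- u x) (D x) (H x) \<le> 0"
    unfolding OU_equation_eq generator_scaleR by simp
qed

text \<open>For every \<open>\<eta>\<close> there is a smooth \<open>w\<close> with Lipschitz constant \<open>L / l\<close> whose distance from \<open>u\<close>, at the two given
  points, is of order \<open>\<eta>\<close>. Here \<open>\<eta>\<close> plays three roles: weight of the
  penalisation, accuracy of the mollification, and accuracy of the approximate solution.\<close>

lemma lipschitz_estimate:
  assumes \<delta>: "0 < \<delta>" and l: "0 < l" "l \<le> k1 - 4" "l \<le> k2 - 4" "l \<le> k3"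
    and F: "\<And>x y. \<bar>F x - F y\<bar> \<le> L * norm (x - y)" and L: "L \<ge> 0"
    and u: "is_u_delta k1 k2 k3 F \<delta> u"
  shows "u y' - u y \<le> L / l * norm (y' - y)"
proof -
  have cont: "continuous_on UNIV u" and sub: "viscosity_subsolution (OU_equation k1 k2 k3 F \<delta>) u"
    and super: "viscosity_supersolution (OU_equation k1 k2 k3 F \<delta>) u"
    using u by (auto simp: is_u_delta_def continuous_viscosity_solution_def)
  obtain C where growth: "\<And>y. \<bar>u y\<bar> \<le> C * (norm y + 1 / \<delta>)"
    using u by (auto simp: is_u_delta_def)
  have \<Lambda>: "L / l \<ge> 0" using L l by simp
  define K where "K = 8 / \<delta> + (norm y)\<^sup>2 + (norm y')\<^sup>2 + 4 / \<delta>"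
  have "u y' - u y \<le> L / l * norm (y' - y) + \<eta> * K" if \<eta>: "\<eta> > 0" for \<eta>
  proof -
    define r where "r = min 1 (\<eta> / (L + 1))"
    have r: "0 < r" "r \<le> 1" using \<eta> L by (auto simp: r_def)
    have "L * r \<le> L * (\<eta> / (L + 1))" using L by (intro mult_left_mono) (auto simp: r_def)
    also have "\<dots> \<le> \<eta>" using L \<eta> by (simp add: pos_divide_le_eq algebra_simps)
    finally have Lr: "L * r \<le> \<eta>" .
    obtain f Df Hf B c where f: "C2_on_Rn f Df Hf"
      "\<And>x z. \<bar>f (x + z) - f x\<bar> \<le> L * norm z"
      "B \<ge> 0" "\<And>x z. \<bar>f (x + z) - f x - z \<bullet> Df x\<bar> \<le> B * (norm z)\<^sup>2"
      "c \<ge> 0" "\<And>x z. \<bar>f (x + z) + f (x - z) - 2 * f x - z \<bullet> (Hf x *v z)\<bar> \<le> c * norm z ^ 3"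
      "\<And>x. \<bar>f x - F x\<bar> \<le> L * r"
      using lipschitz_mollification[OF F L r] by metis
    let ?R = "1 + (C + L / l + 2 * C / \<delta>) / \<eta>"
    obtain w Dw Hw where w: "C2_on_Rn w Dw Hw"
      "\<And>x z. \<bar>w (x + z) - w x\<bar> \<le> L / l * norm z"
      "\<And>x. norm x \<le> ?R \<Longrightarrow> \<bar>\<delta> * w x - generator x (Dw x) (Hw x) - f x\<bar> \<le> \<eta>"
      using approximate_solution[OF \<delta> \<eta> l f(1,2) L f(4,3,6,5), of ?R] by metis
    have res: "\<bar>\<delta> * w x - generator x (Dw x) (Hw x) - F x\<bar> \<le> 2 * \<eta>" if "norm x \<le> ?R" for x
      using w(3)[OF that] f(7)[of x] Lr unfolding abs_le_iff by linarith
    have upper: "u y' - w y' \<le> \<eta> * (4 / \<delta> + (norm y')\<^sup>2) + 2 * \<eta> / \<delta>"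
    proof (rule subsolution_le_approximate_supersolution[OF \<delta> \<eta> \<Lambda> cont sub growth w(1,2)])
      show "- (2 * \<eta>) \<le> \<delta> * w x - generator x (Dw x) (Hw x) - F x" if "norm x \<le> ?R" for x
        using res[OF that] by linarith
    qed
    have lower: "- u y - (- 1 * w y) \<le> \<eta> * (4 / \<delta> + (norm y)\<^sup>2) + 2 * \<eta> / \<delta>"
    proof (rule subsolution_le_approximate_supersolution[OF \<delta> \<eta> \<Lambda> continuous_on_minus[OF cont]
          viscosity_supersolution_uminus[OF super] _ C2_on_Rn_scaleR[OF w(1)]])
      show "\<bar>- u y\<bar> \<le> C * (norm y + 1 / \<delta>)" for y using growth[of y] by simp
      show "\<bar>- 1 * w (x + z) - - 1 * w x\<bar> \<le> L / l * norm z" for x z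
        using w(2)[of x z] by simp
      show "- (2 * \<eta>) \<le> \<delta> * (- 1 * w x) - generator x (- 1 *\<^sub>R Dw x) (- 1 *\<^sub>R Hw x) - - F x"
        if "norm x \<le> ?R" for x
        using res[OF that] unfolding generator_scaleR by linarith
    qed
    have "u y' - u y \<le> (w y' - w y) + (\<eta> * (4 / \<delta> + (norm y')\<^sup>2) + 2 * \<eta> / \<delta>)
        + (\<eta> * (4 / \<delta> + (norm y)\<^sup>2) + 2 * \<eta> / \<delta>)"
      using upper lower by simp
    also have "\<dots> = (w y' - w y) + \<eta> * K"
      by (simp add: K_def field_simps)
    also have "\<dots> \<le> L / l * norm (y' - y) + \<eta> * K"
      using w(2)[of y "y' - y"] by simp
    finally show ?thesis .
  qed
  then have *: "u y' - u y - L / l * norm (y' - y) \<le> \<eta> * K" if "\<eta> > 0" for \<eta>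
    unfolding diff_le_eq[of "u y' - u y"] add.commute[of "\<eta> * K"] using that .
  have K: "K > 0" unfolding K_def using \<delta> by (intro add_pos_nonneg add_nonneg_pos) auto
  have "u y' - u y - L / l * norm (y' - y) \<le> 0"
  proof (rule field_le_epsilon)
    fix e :: real assume "e > 0"
    then show "u y' - u y - L / l * norm (y' - y) \<le> 0 + e"
      using *[of "e / K"] K by simp
  qed
  then show ?thesis by simp
qed

end

section \<open>The Lipschitz estimate\<close>

theorem theorem3p2:
  fixes k1 k2 k3 L C\<^sub>F :: real
    and F :: "real^3 \<Rightarrow> real"
  assumes "k1 > 4" and "k2 > 4" and "k3 > 0"
    and "L-lipschitz_on UNIV F"
    and "\<And>y. \<bar>F y\<bar> \<le> C\<^sub>F * (norm y + 1)"
  shows "(\<forall>\<psi>. concave_on UNIV \<psi> \<and> mono \<psi> \<and> C2_real \<psi> \<and> \<psi> 0 = 0 \<and>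
              (\<forall>s. deriv \<psi> s > Max {L / (k1 - 4), L / (k2 - 4), L / k3}) \<longrightarrow>
            (\<forall>\<delta>>0. \<forall>u. is_u_delta k1 k2 k3 F \<delta> u \<longrightarrow>
              (\<forall>y y'. \<bar>u y' - u y\<bar> \<le> \<psi> (norm (y' - y)))))
       \<and> (\<forall>Lbar. Lbar > L / Min {k1 - 4, k2 - 4, k3} \<longrightarrow>
            (\<forall>\<delta>>0. \<forall>u. is_u_delta k1 k2 k3 F \<delta> u \<longrightarrow>
              (\<forall>y y'. \<bar>u y' - u y\<bar> \<le> Lbar * norm (y' - y))))"
proof -
  interpret ornstein_uhlenbeck k1 k2 k3
    using assms by unfold_locales
  define l where "l = Min {k1 - 4, k2 - 4, k3}"
  have l: "0 < l" "l \<le> k1 - 4" "l \<le> k2 - 4" "l \<le> k3" "l = k1 - 4 \<or> l = k2 - 4 \<or> l = k3"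
    using assms by (auto simp: l_def min_def)
  have L: "L \<ge> 0" and F: "\<bar>F x - F y\<bar> \<le> L * norm (x - y)" for x y
    using lipschitz_on_nonneg[OF assms(4)] lipschitz_onD[OF assms(4), of x y] by (auto simp: dist_norm)
  have est: "\<bar>u y' - u y\<bar> \<le> L / l * norm (y' - y)" if "\<delta> > 0" "is_u_delta k1 k2 k3 F \<delta> u" for \<delta> u y y'
    using lipschitz_estimate[OF that(1) l(1-4) F L that(2), of y' y]
      lipschitz_estimate[OF that(1) l(1-4) F L that(2), of y y']
    by (simp add: abs_le_iff norm_minus_commute)
  have below: "L / l * s \<le> \<psi> s"
    if C2: "C2_real \<psi>" and 0: "\<psi> 0 = 0" and s: "0 \<le> s"
      and d: "\<And>s. deriv \<psi> s > Max {L / (k1 - 4), L / (k2 - 4), L / k3}" for \<psi> s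
  proof (cases "s = 0")
    case False
    have "(\<psi> has_real_derivative deriv \<psi> t) (at t)" for t
      using C2 by (simp add: C2_real_def DERIV_deriv_iff_real_differentiable)
    then obtain t where "\<psi> s - \<psi> 0 = (s - 0) * deriv \<psi> t"
      using MVT2[of 0 s \<psi> "deriv \<psi>"] False s by auto
    moreover have "L / l \<le> deriv \<psi> t"
      using l(5) less_imp_le[OF d[of t]] by (auto simp: Max_ge_iff)
    ultimately show ?thesis
      using 0 mult_right_mono[of "L / l" "deriv \<psi> t" s] s by (simp add: mult.commute)
  qed (use 0 in simp)
  show ?thesis
  proof (intro conjI allI impI; (elim conjE)?)
    fix \<psi> :: "real \<Rightarrow> real" and \<delta> u and y y' :: "real^3"
    assume "C2_real \<psi>" "\<psi> 0 = 0" "\<forall>s. deriv \<psi> s > Max {L / (k1 - 4), L / (k2 - 4), L / k3}"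
      and u: "\<delta> > 0" "is_u_delta k1 k2 k3 F \<delta> u"
    then have "L / l * norm (y' - y) \<le> \<psi> (norm (y' - y))"
      by (intro below) auto
    with est[OF u] show "\<bar>u y' - u y\<bar> \<le> \<psi> (norm (y' - y))"
      by (rule order_trans)
  next
    fix Lbar \<delta> u and y y' :: "real^3"
    assume "L / Min {k1 - 4, k2 - 4, k3} < Lbar" "\<delta> > 0" "is_u_delta k1 k2 k3 F \<delta> u"
    then show "\<bar>u y' - u y\<bar> \<le> Lbar * norm (y' - y)"
      by (intro order_trans[OF est mult_right_mono]) (auto simp: l_def)
  qed
qed

end
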